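(* Let $\mathfrak{C}$ be a restriction category with restriction products and restriction terminal object (i.e. a partial cartesian category, with its induced restriction structure) whose restriction idempotents split and whose monics have quasi-inverses. Then the following are equivalent: (1) $\mathfrak{C}$ has weak comma objects; (2) the objects of $\mathfrak{C}$ have stable Heyting operations on their restriction idempotents.
   Context: Composition: $gf$ means first $f$, then $g$. A partial cartesian category (bicategory of partial maps) is a locally posetal symmetric monoidal bicategory $\mathfrak{C}$ (each hom-set is a poset, with order $\sqsubseteq$, compatible with composition and $\otimes$) such that every object $A$ has a unique cocommutative comonoid structure $\Delta_A:A\to A\otimes A$, $!_A:A\to I$ ($I$ the monoidal unit), with $\Delta$ strictly natural and $!$ lax natural ($!_B f\sqsubseteq\, !_A$ for $f:A\to B$), and such that $\Delta_A$ has a right adjoint $\nabla_A$ with $\Delta_A\nabla_A=(\nabla_A\otimes \mathrm{id})(\mathrm{id}\otimes\Delta_A)$ and $\nabla_B(f\otimes g)\Delta_A\sqsubseteq f$ for all $f,g:A\to B$. Its restriction structure assigns to $f:A\to B$ the map $\overline f:A\to A$ given by $A\xrightarrow{\Delta_A}A\otimes A\xrightarrow{\mathrm{id}\otimes(!_Bf)}A\otimes I\cong A$; then $f\sqsubseteq g$ iff $f=g\overline f$. A map $f$ is total if $\overline f=\mathrm{id}$ (equivalently $!_Bf=\,!_A$). A restriction idempotent on $A$ is a map $\alpha:A\to A$ with $\alpha=\overline\alpha$; it splits if $\alpha=ir$ with $r:A\to A_0$, $i:A_0\to A$, $ri=\mathrm{id}$. A map $f:A\to B$ is monic if $\nabla_B(f\otimes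 f)=f\nabla_A$. A quasi-inverse of a monic $f$ is a map $f^\dagger:B\to A$ with $\overline f=f^\dagger f$ and $\overline{f^\dagger}=ff^\dagger$. $\mathfrak{C}$ has weak comma objects if for all $f:A\to B$, $g:C\to B$ there are an object $f/g$ and total maps $\hat g:f/g\to A$, $\hat f:f/g\to C$ with $f\hat g\sqsubseteq g\hat f$ such that, for all $\phi:S\to A$, $\psi:S\to C$ with $f\phi\sqsubseteq g\psi$, there is a unique $\langle\phi,\psi\rangle:S\to f/g$ with $\hat g\langle\phi,\psi\rangle=\phi\overline\psi$ and $\hat f\langle\phi,\psi\rangle=\psi\overline\phi$. An object $A$ has a stable Heyting operation if for any two restriction idempotents $\alpha,\beta$ on $A$ there is a restriction idempotent $\alpha\Rightarrow\beta$ on $A$ such that for every map $f:S\to A$: $\alpha f\sqsubseteq\beta f$ if and only if $f\sqsubseteq(\alpha\Rightarrow\beta)f$. *)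

theory Defs
  imports Main
begin

section \<open>Locally posetal symmetric monoidal bicategories\<close>

text \<open>
  In a locally posetal bicategory the only invertible 2-cells are identities, so such a
  bicategory is a category with partially ordered hom-sets and monotone composition, and the
  data and axioms of a symmetric monoidal structure on it hold up to equality. We write
  \<open>g \<cdot> f\<close> for ``first \<open>f\<close>, then \<open>g\<close>'', \<open>A \<odot> B\<close> for the tensor
  of objects and \<open>f \<otimes> g\<close> for the tensor of maps. Following Mac Lane, the associator
  \<open>\<alpha> A B D\<close> goes from \<open>A \<odot> (B \<odot> D)\<close> to \<open>(A \<odot> B) \<odot> D\<close>.
\<close>

record ('o, 'm) ordered_cat =
  Ob :: "'o set"
  Ar :: "'m set"
  src :: "'m \<Rightarrow> 'o"
  trg :: "'m \<Rightarrow> 'o"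
  ident :: "'o \<Rightarrow> 'm" ("\<iota>\<index>")
  cmp :: "'m \<Rightarrow> 'm \<Rightarrow> 'm" (infixl "\<cdot>\<index>" 70)
  below :: "'m \<Rightarrow> 'm \<Rightarrow> bool" (infix "\<sqsubseteq>\<index>" 50)

record ('o, 'm) monoidal_cat = "('o, 'm) ordered_cat" +
  unit_ob :: "'o" ("\<I>\<index>")
  tensor_ob :: "'o \<Rightarrow> 'o \<Rightarrow> 'o" (infixl "\<odot>\<index>" 75)
  tensor :: "'m \<Rightarrow> 'm \<Rightarrow> 'm" (infixl "\<otimes>\<index>" 75)
  assoc :: "'o \<Rightarrow> 'o \<Rightarrow> 'o \<Rightarrow> 'm" ("\<alpha>\<index>")
  lunit :: "'o \<Rightarrow> 'm" ("\<ell>\<index>")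
  runit :: "'o \<Rightarrow> 'm" ("\<rho>\<index>")
  swap :: "'o \<Rightarrow> 'o \<Rightarrow> 'm" ("\<sigma>\<index>")

record ('o, 'm) partial_cartesian_cat = "('o, 'm) monoidal_cat" +
  diag :: "'o \<Rightarrow> 'm" ("\<Delta>\<index>")
  bang :: "'o \<Rightarrow> 'm" ("\<epsilon>\<index>")
  codiag :: "'o \<Rightarrow> 'm" ("\<nabla>\<index>")

definition hom :: "('o, 'm, 'x) ordered_cat_scheme \<Rightarrow> 'o \<Rightarrow> 'o \<Rightarrow> 'm set" where
  "hom C A B = {f \<in> Ar C. src C f = A \<and> trg C f = B}"

definition is_iso :: "('o, 'm, 'x) ordered_cat_scheme \<Rightarrow> 'o \<Rightarrow> 'o \<Rightarrow> 'm \<Rightarrow> bool" where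
  "is_iso C A B f \<longleftrightarrow> f \<in> hom C A B \<and>
     (\<exists>g \<in> hom C B A. cmp C g f = ident C A \<and> cmp C f g = ident C B)"

locale locally_posetal_category =
  fixes C :: "('o, 'm, 'x) ordered_cat_scheme" (structure)
  assumes src_Ob: "f \<in> Ar C \<Longrightarrow> src C f \<in> Ob C"
    and trg_Ob: "f \<in> Ar C \<Longrightarrow> trg C f \<in> Ob C"
    and ident_hom: "A \<in> Ob C \<Longrightarrow> \<iota> A \<in> hom C A A"
    and cmp_hom: "\<lbrakk>f \<in> hom C A B; g \<in> hom C B D\<rbrakk> \<Longrightarrow> g \<cdot> f \<in> hom C A D"
    and cmp_ident_left: "f \<in> hom C A B \<Longrightarrow> \<iota> B \<cdot> f = f"
    and cmp_ident_right: "f \<in> hom C A B \<Longrightarrow> f \<cdot> \<iota> A = f"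
    and cmp_assoc: "\<lbrakk>f \<in> hom C A B; g \<in> hom C B D; h \<in> hom C D E\<rbrakk>
      \<Longrightarrow> (h \<cdot> g) \<cdot> f = h \<cdot> (g \<cdot> f)"
    and below_refl: "f \<in> hom C A B \<Longrightarrow> f \<sqsubseteq> f"
    and below_trans: "\<lbrakk>f \<in> hom C A B; g \<in> hom C A B; h \<in> hom C A B; f \<sqsubseteq> g; g \<sqsubseteq> h\<rbrakk>
      \<Longrightarrow> f \<sqsubseteq> h"
    and below_antisym: "\<lbrakk>f \<in> hom C A B; g \<in> hom C A B; f \<sqsubseteq> g; g \<sqsubseteq> f\<rbrakk> \<Longrightarrow> f = g"
    and cmp_mono: "\<lbrakk>f \<in> hom C A B; f' \<in> hom C A B; g \<in> hom C B D; g' \<in> hom C B D;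
      f \<sqsubseteq> f'; g \<sqsubseteq> g'\<rbrakk> \<Longrightarrow> g \<cdot> f \<sqsubseteq> g' \<cdot> f'"

locale locally_posetal_symmetric_monoidal = locally_posetal_category C
  for C :: "('o, 'm, 'x) monoidal_cat_scheme" (structure) +
  assumes unit_Ob: "\<I> \<in> Ob C"
    and tensor_Ob: "\<lbrakk>A \<in> Ob C; B \<in> Ob C\<rbrakk> \<Longrightarrow> A \<odot> B \<in> Ob C"
    and tensor_hom: "\<lbrakk>f \<in> hom C A B; g \<in> hom C D E\<rbrakk> \<Longrightarrow> f \<otimes> g \<in> hom C (A \<odot> D) (B \<odot> E)"
    and tensor_ident: "\<lbrakk>A \<in> Ob C; B \<in> Ob C\<rbrakk> \<Longrightarrow> \<iota> A \<otimes> \<iota> B = \<iota> (A \<odot> B)"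
    and tensor_cmp: "\<lbrakk>f \<in> hom C A B; g \<in> hom C B D; f' \<in> hom C A' B'; g' \<in> hom C B' D'\<rbrakk>
      \<Longrightarrow> (g \<cdot> f) \<otimes> (g' \<cdot> f') = (g \<otimes> g') \<cdot> (f \<otimes> f')"
    and tensor_mono: "\<lbrakk>f \<in> hom C A B; f' \<in> hom C A B; g \<in> hom C D E; g' \<in> hom C D E;
      f \<sqsubseteq> f'; g \<sqsubseteq> g'\<rbrakk> \<Longrightarrow> f \<otimes> g \<sqsubseteq> f' \<otimes> g'"
    and assoc_iso: "\<lbrakk>A \<in> Ob C; B \<in> Ob C; D \<in> Ob C\<rbrakk>
      \<Longrightarrow> is_iso C (A \<odot> (B \<odot> D)) ((A \<odot> B) \<odot> D) (\<alpha> A B D)"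
    and lunit_iso: "A \<in> Ob C \<Longrightarrow> is_iso C (\<I> \<odot> A) A (\<ell> A)"
    and runit_iso: "A \<in> Ob C \<Longrightarrow> is_iso C (A \<odot> \<I>) A (\<rho> A)"
    and swap_hom: "\<lbrakk>A \<in> Ob C; B \<in> Ob C\<rbrakk> \<Longrightarrow> \<sigma> A B \<in> hom C (A \<odot> B) (B \<odot> A)"
    and assoc_natural: "\<lbrakk>f \<in> hom C A A'; g \<in> hom C B B'; h \<in> hom C D D'\<rbrakk>
      \<Longrightarrow> \<alpha> A' B' D' \<cdot> (f \<otimes> (g \<otimes> h)) = ((f \<otimes> g) \<otimes> h) \<cdot> \<alpha> A B D"
    and lunit_natural: "f \<in> hom C A B \<Longrightarrow> \<ell> B \<cdot> (\<iota> \<I> \<otimes> f) = f \<cdot> \<ell> A"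
    and runit_natural: "f \<in> hom C A B \<Longrightarrow> \<rho> B \<cdot> (f \<otimes> \<iota> \<I>) = f \<cdot> \<rho> A"
    and swap_natural: "\<lbrakk>f \<in> hom C A B; g \<in> hom C D E\<rbrakk>
      \<Longrightarrow> \<sigma> B E \<cdot> (f \<otimes> g) = (g \<otimes> f) \<cdot> \<sigma> A D"
    and pentagon: "\<lbrakk>A \<in> Ob C; B \<in> Ob C; D \<in> Ob C; E \<in> Ob C\<rbrakk>
      \<Longrightarrow> \<alpha> (A \<odot> B) D E \<cdot> \<alpha> A B (D \<odot> E)
        = (\<alpha> A B D \<otimes> \<iota> E) \<cdot> \<alpha> A (B \<odot> D) E \<cdot> (\<iota> A \<otimes> \<alpha> B D E)"
    and triangle: "\<lbrakk>A \<in> Ob C; B \<in> Ob C\<rbrakk> \<Longrightarrow> (\<rho> A \<otimes> \<iota> B) \<cdot> \<alpha> A \<I> B = \<iota> A \<otimes> \<ell> B"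
    and unit_coherence: "\<ell> \<I> = \<rho> \<I>"
    and swap_swap: "\<lbrakk>A \<in> Ob C; B \<in> Ob C\<rbrakk> \<Longrightarrow> \<sigma> B A \<cdot> \<sigma> A B = \<iota> (A \<odot> B)"
    and swap_unit: "A \<in> Ob C \<Longrightarrow> \<ell> A \<cdot> \<sigma> A \<I> = \<rho> A"
    and hexagon: "\<lbrakk>A \<in> Ob C; B \<in> Ob C; D \<in> Ob C\<rbrakk>
      \<Longrightarrow> \<alpha> D A B \<cdot> \<sigma> (A \<odot> B) D \<cdot> \<alpha> A B D
        = (\<sigma> A D \<otimes> \<iota> B) \<cdot> \<alpha> A D B \<cdot> (\<iota> A \<otimes> \<sigma> B D)"

section \<open>Partial cartesian categories\<close>

context
  fixes C :: "('o, 'm, 'x) monoidal_cat_scheme" (structure)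
begin

definition cocommutative_comonoid :: "'o \<Rightarrow> 'm \<Rightarrow> 'm \<Rightarrow> bool" where
  "cocommutative_comonoid A d e \<longleftrightarrow>
     d \<in> hom C A (A \<odot> A) \<and> e \<in> hom C A \<I> \<and>
     (d \<otimes> \<iota> A) \<cdot> d = \<alpha> A A A \<cdot> (\<iota> A \<otimes> d) \<cdot> d \<and>
     \<ell> A \<cdot> (e \<otimes> \<iota> A) \<cdot> d = \<iota> A \<and>
     \<rho> A \<cdot> (\<iota> A \<otimes> e) \<cdot> d = \<iota> A \<and>
     \<sigma> A A \<cdot> d = d"

end

text \<open>
  The maps \<open>\<epsilon> A\<close> are the counits \<open>!\<^sub>A\<close>. Since \<open>\<Delta>\<close>, \<open>\<epsilon>\<close> and
  \<open>\<nabla>\<close> are uniquely determined by the axioms, carrying them as data is no restriction.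
\<close>

locale partial_cartesian_category = locally_posetal_symmetric_monoidal C
  for C :: "('o, 'm, 'x) partial_cartesian_cat_scheme" (structure) +
  assumes comonoid: "A \<in> Ob C \<Longrightarrow> cocommutative_comonoid C A (\<Delta> A) (\<epsilon> A)"
    and comonoid_unique: "\<lbrakk>A \<in> Ob C; cocommutative_comonoid C A d e\<rbrakk> \<Longrightarrow> d = \<Delta> A \<and> e = \<epsilon> A"
    and diag_natural: "f \<in> hom C A B \<Longrightarrow> \<Delta> B \<cdot> f = (f \<otimes> f) \<cdot> \<Delta> A"
    and bang_lax_natural: "f \<in> hom C A B \<Longrightarrow> \<epsilon> B \<cdot> f \<sqsubseteq> \<epsilon> A"
    and codiag_hom: "A \<in> Ob C \<Longrightarrow> \<nabla> A \<in> hom C (A \<odot> A) A"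
    and adjunction_unit: "A \<in> Ob C \<Longrightarrow> \<iota> A \<sqsubseteq> \<nabla> A \<cdot> \<Delta> A"
    and adjunction_counit: "A \<in> Ob C \<Longrightarrow> \<Delta> A \<cdot> \<nabla> A \<sqsubseteq> \<iota> (A \<odot> A)"
    and frobenius: "A \<in> Ob C
      \<Longrightarrow> \<Delta> A \<cdot> \<nabla> A = (\<nabla> A \<otimes> \<iota> A) \<cdot> \<alpha> A A A \<cdot> (\<iota> A \<otimes> \<Delta> A)"
    and convolution_below: "\<lbrakk>f \<in> hom C A B; g \<in> hom C A B\<rbrakk>
      \<Longrightarrow> \<nabla> B \<cdot> (f \<otimes> g) \<cdot> \<Delta> A \<sqsubseteq> f"

section \<open>Restriction structure\<close>

context
  fixes C :: "('o, 'm, 'x) partial_cartesian_cat_scheme" (structure)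
begin

definition restr :: "'m \<Rightarrow> 'm" where
  "restr f = \<rho> (src C f) \<cdot> (\<iota> (src C f) \<otimes> (\<epsilon> (trg C f) \<cdot> f)) \<cdot> \<Delta> (src C f)"

definition total :: "'m \<Rightarrow> bool" where
  "total f \<longleftrightarrow> restr f = \<iota> (src C f)"

definition restriction_idempotent :: "'o \<Rightarrow> 'm \<Rightarrow> bool" where
  "restriction_idempotent A a \<longleftrightarrow> a \<in> hom C A A \<and> a = restr a"

definition splits :: "'o \<Rightarrow> 'm \<Rightarrow> bool" where
  "splits A a \<longleftrightarrow>
     (\<exists>A\<^sub>0 \<in> Ob C. \<exists>r \<in> hom C A A\<^sub>0. \<exists>i \<in> hom C A\<^sub>0 A. a = i \<cdot> r \<and> r \<cdot> i = \<iota> A\<^sub>0)"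

definition restriction_idempotents_split :: bool where
  "restriction_idempotents_split \<longleftrightarrow>
     (\<forall>A \<in> Ob C. \<forall>a. restriction_idempotent A a \<longrightarrow> splits A a)"

text \<open>
  This is the equational notion of monic map for partial maps, not left cancellability.
\<close>

definition monic :: "'m \<Rightarrow> bool" where
  "monic f \<longleftrightarrow> f \<in> Ar C \<and> \<nabla> (trg C f) \<cdot> (f \<otimes> f) = f \<cdot> \<nabla> (src C f)"

definition quasi_inverse :: "'m \<Rightarrow> 'm \<Rightarrow> bool" where
  "quasi_inverse f f' \<longleftrightarrow> f' \<in> hom C (trg C f) (src C f) \<and>
     restr f = f' \<cdot> f \<and> restr f' = f \<cdot> f'"

definition monics_have_quasi_inverses :: bool where
  "monics_have_quasi_inverses \<longleftrightarrow> (\<forall>f. monic f \<longrightarrow> (\<exists>f'. quasi_inverse f f'))"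

section \<open>Weak comma objects and stable Heyting operations\<close>

text \<open>
  \<open>weak_comma f g P p q\<close>: the object \<open>P\<close> with \<open>p : P \<rightarrow> A\<close> and
  \<open>q : P \<rightarrow> D\<close> is a weak comma object of \<open>f : A \<rightarrow> B\<close> and
  \<open>g : D \<rightarrow> B\<close>.
\<close>

definition weak_comma :: "'m \<Rightarrow> 'm \<Rightarrow> 'o \<Rightarrow> 'm \<Rightarrow> 'm \<Rightarrow> bool" where
  "weak_comma f g P p q \<longleftrightarrow>
     P \<in> Ob C \<and> p \<in> hom C P (src C f) \<and> q \<in> hom C P (src C g) \<and>
     total p \<and> total q \<and> f \<cdot> p \<sqsubseteq> g \<cdot> q \<and>
     (\<forall>S \<in> Ob C. \<forall>\<phi> \<in> hom C S (src C f). \<forall>\<psi> \<in> hom C S (src C g).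
        f \<cdot> \<phi> \<sqsubseteq> g \<cdot> \<psi> \<longrightarrow>
        (\<exists>!h. h \<in> hom C S P \<and> p \<cdot> h = \<phi> \<cdot> restr \<psi> \<and> q \<cdot> h = \<psi> \<cdot> restr \<phi>))"

definition has_weak_comma_objects :: bool where
  "has_weak_comma_objects \<longleftrightarrow>
     (\<forall>A \<in> Ob C. \<forall>B \<in> Ob C. \<forall>D \<in> Ob C. \<forall>f \<in> hom C A B. \<forall>g \<in> hom C D B.
        \<exists>P p q. weak_comma f g P p q)"

definition has_stable_Heyting_operation :: "'o \<Rightarrow> bool" where
  "has_stable_Heyting_operation A \<longleftrightarrow>
     (\<forall>a b. restriction_idempotent A a \<longrightarrow> restriction_idempotent A b \<longrightarrow>
        (\<exists>c. restriction_idempotent A c \<and>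
           (\<forall>S \<in> Ob C. \<forall>f \<in> hom C S A. a \<cdot> f \<sqsubseteq> b \<cdot> f \<longleftrightarrow> f \<sqsubseteq> c \<cdot> f)))"

end

end

theory Submission
  imports Defs
begin

text \<open>
  Tensoring two comonoids gives a comonoid, so uniqueness of comonoid structures makes \<open>A \<odot> B\<close>
  a restriction product. The Frobenius law then shows that \<open>f \<sqsubseteq> g\<close> holds iff \<open>f\<close> is the
  restriction of \<open>g\<close> to the domain of \<open>f\<close>, and that \<open>\<nabla> \<cdot> (f \<otimes> g) \<cdot> \<Delta>\<close> is the meet of \<open>f\<close> and
  \<open>g\<close>.

  Given Heyting operations, the weak comma object of \<open>f\<close> and \<open>g\<close> splits the idempotent
  ``if \<open>f x\<close> is defined, then \<open>f x\<close> and \<open>g y\<close> are defined and equal'' on \<open>A \<odot> D\<close>. Conversely, let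
  \<open>p\<close> and \<open>q\<close> be the projections of the weak comma object of two restriction idempotents
  \<open>a\<close> and \<open>b\<close>. The meet of \<open>p\<close> and \<open>q\<close> is monic with image the set of \<open>x\<close> such that \<open>x \<in> a\<close> implies
  \<open>x \<in> b\<close>, and the domain of its quasi-inverse is \<open>a \<Rightarrow> b\<close>.
\<close>

section \<open>Symmetric monoidal coherence\<close>

context locally_posetal_category
begin

lemma hom_iff: "f \<in> hom C A B \<longleftrightarrow> f \<in> Ar C \<and> src C f = A \<and> trg C f = B"
  by (auto simp: hom_def)

lemma hom_self: "f \<in> Ar C \<Longrightarrow> f \<in> hom C (src C f) (trg C f)"
  by (simp add: hom_iff)

lemma ident_typ [simp]:
  assumes "A \<in> Ob C"
  shows "\<iota> A \<in> Ar C" "src C (\<iota> A) = A" "trg C (\<iota> A) = A"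
  using ident_hom[OF assms] by (auto simp: hom_iff)

text \<open>Splitting hom-set membership into \<open>Ar\<close>, \<open>src\<close> and
  \<open>trg\<close> lets the simplifier compute sources and targets, and so discharge the side
  conditions of the equations below.\<close>

lemma cmp_typ [simp]:
  assumes "f \<in> Ar C" "g \<in> Ar C" "trg C f = src C g"
  shows "g \<cdot> f \<in> Ar C" "src C (g \<cdot> f) = src C f" "trg C (g \<cdot> f) = trg C g"
  using cmp_hom[of f "src C f" "src C g" g "trg C g"] assms by (auto simp: hom_iff)

lemma cmp_left_ident [simp]: "\<lbrakk>f \<in> Ar C; trg C f = B\<rbrakk> \<Longrightarrow> \<iota> B \<cdot> f = f"
  using cmp_ident_left[of f "src C f" B] by (simp add: hom_iff)

lemma cmp_right_ident [simp]: "\<lbrakk>f \<in> Ar C; src C f = A\<rbrakk> \<Longrightarrow> f \<cdot> \<iota> A = f"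
  using cmp_ident_right[of f A "trg C f"] by (simp add: hom_iff)

lemma cmp_reassoc:
  "\<lbrakk>f \<in> Ar C; g \<in> Ar C; h \<in> Ar C; trg C f = src C g; trg C g = src C h\<rbrakk>
    \<Longrightarrow> (h \<cdot> g) \<cdot> f = h \<cdot> (g \<cdot> f)"
  using cmp_assoc[of f "src C f" "trg C f" g "trg C g" h "trg C h"] by (simp add: hom_iff)

text \<open>Composites are kept nested to the right, where an equation for
  \<open>h \<cdot> g\<close> no longer matches inside a longer chain. This form of the equation
  carries an arbitrary tail \<open>f\<close>.\<close>

lemma cmp_subst_left:
  "\<lbrakk>h \<cdot> g = k; f \<in> Ar C; g \<in> Ar C; h \<in> Ar C; trg C f = src C g; trg C g = src C h\<rbrakk>
    \<Longrightarrow> h \<cdot> (g \<cdot> f) = k \<cdot> f"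
  using cmp_reassoc[of f g h] by simp

lemma cmp_subst_left3:
  "\<lbrakk>h \<cdot> (g \<cdot> f) = k; e \<in> Ar C; f \<in> Ar C; g \<in> Ar C; h \<in> Ar C;
    trg C e = src C f; trg C f = src C g; trg C g = src C h\<rbrakk>
    \<Longrightarrow> h \<cdot> (g \<cdot> (f \<cdot> e)) = k \<cdot> e"
  by (auto simp: cmp_reassoc)

lemma src_trg_Ob [simp]: "f \<in> Ar C \<Longrightarrow> src C f \<in> Ob C" "f \<in> Ar C \<Longrightarrow> trg C f \<in> Ob C"
  by (rule src_Ob trg_Ob, assumption)+

lemma below_refl': "f \<in> Ar C \<Longrightarrow> f \<sqsubseteq> f"
  using below_refl[OF hom_self] .

lemma below_antisym':
  "\<lbrakk>f \<sqsubseteq> g; g \<sqsubseteq> f; f \<in> Ar C; g \<in> Ar C; src C f = src C g; trg C f = trg C g\<rbrakk> \<Longrightarrow> f = g"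
  using below_antisym[of f "src C f" "trg C f" g] by (simp add: hom_iff)

lemma below_trans':
  "\<lbrakk>f \<sqsubseteq> g; g \<sqsubseteq> h; f \<in> Ar C; g \<in> Ar C; h \<in> Ar C; src C f = src C g; trg C f = trg C g;
    src C g = src C h; trg C g = trg C h\<rbrakk> \<Longrightarrow> f \<sqsubseteq> h"
  using below_trans[of f "src C f" "trg C f" g h] by (simp add: hom_iff)

lemma below_cmp_left:
  "\<lbrakk>f \<sqsubseteq> g; f \<in> Ar C; g \<in> Ar C; h \<in> Ar C; src C f = src C g; trg C f = trg C g; trg C g = src C h\<rbrakk>
    \<Longrightarrow> h \<cdot> f \<sqsubseteq> h \<cdot> g"
  using cmp_mono[of f "src C f" "trg C f" g h "trg C h" h] below_refl'[of h] by (simp add: hom_iff)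

lemma below_cmp_right:
  "\<lbrakk>f \<sqsubseteq> g; f \<in> Ar C; g \<in> Ar C; h \<in> Ar C; src C f = src C g; trg C f = trg C g; trg C h = src C g\<rbrakk>
    \<Longrightarrow> f \<cdot> h \<sqsubseteq> g \<cdot> h"
  using cmp_mono[of h "src C h" "src C f" h f "trg C f" g] below_refl'[of h] by (simp add: hom_iff)

end

section \<open>Monoidal calculus and the unit coherence law\<close>

context locally_posetal_symmetric_monoidal
begin

lemma unit_typ [simp]: "\<I> \<in> Ob C" by (rule unit_Ob)

lemma tensor_Ob' [simp]: "\<lbrakk>A \<in> Ob C; B \<in> Ob C\<rbrakk> \<Longrightarrow> A \<odot> B \<in> Ob C" by (rule tensor_Ob)

lemma tensor_typ [simp]:
  assumes "f \<in> Ar C" "g \<in> Ar C"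
  shows "f \<otimes> g \<in> Ar C" "src C (f \<otimes> g) = src C f \<odot> src C g" "trg C (f \<otimes> g) = trg C f \<odot> trg C g"
  using tensor_hom[OF hom_self hom_self, OF assms] by (auto simp: hom_iff)

lemma tensor_interchange:
  assumes "f \<in> Ar C" "g \<in> Ar C" "f' \<in> Ar C" "g' \<in> Ar C" "trg C f = src C g" "trg C f' = src C g'"
  shows "(g \<otimes> g') \<cdot> (f \<otimes> f') = (g \<cdot> f) \<otimes> (g' \<cdot> f')"
  using tensor_cmp[of f "src C f" "trg C f" g "trg C g" f' "src C f'" "trg C f'" g' "trg C g'"] assms
  by (simp add: hom_iff)

lemmas tensor_interchange_tail = cmp_subst_left[OF tensor_interchange]

lemma tensor_ident' [simp]: "\<lbrakk>A \<in> Ob C; B \<in> Ob C\<rbrakk> \<Longrightarrow> \<iota> A \<otimes> \<iota> B = \<iota> (A \<odot> B)"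
  by (rule tensor_ident)

text \<open>\<open>assoc_iso\<close> only asserts that the associator has an inverse; the choice
  makes that inverse available as a family of maps.\<close>

definition assoc_inv ("\<beta>") where
  "\<beta> A B D = (SOME g. g \<in> hom C ((A \<odot> B) \<odot> D) (A \<odot> (B \<odot> D)) \<and>
     g \<cdot> \<alpha> A B D = \<iota> (A \<odot> (B \<odot> D)) \<and> \<alpha> A B D \<cdot> g = \<iota> ((A \<odot> B) \<odot> D))"

lemma assoc_inv_props:
  assumes "A \<in> Ob C" "B \<in> Ob C" "D \<in> Ob C"
  shows "\<beta> A B D \<in> hom C ((A \<odot> B) \<odot> D) (A \<odot> (B \<odot> D)) \<and>
     \<beta> A B D \<cdot> \<alpha> A B D = \<iota> (A \<odot> (B \<odot> D)) \<and> \<alpha> A B D \<cdot> \<beta> A B D = \<iota> ((A \<odot> B) \<odot> D)"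
  unfolding assoc_inv_def by (rule someI_ex) (use assoc_iso[OF assms] in \<open>auto simp: is_iso_def\<close>)

lemma structure_typ [simp]:
  assumes "A \<in> Ob C"
  shows "\<ell> A \<in> Ar C" "src C (\<ell> A) = \<I> \<odot> A" "trg C (\<ell> A) = A"
    and "\<rho> A \<in> Ar C" "src C (\<rho> A) = A \<odot> \<I>" "trg C (\<rho> A) = A"
  using lunit_iso[OF assms] runit_iso[OF assms] by (auto simp: is_iso_def hom_iff)

lemma swap_typ [simp]:
  assumes "A \<in> Ob C" "B \<in> Ob C"
  shows "\<sigma> A B \<in> Ar C" "src C (\<sigma> A B) = A \<odot> B" "trg C (\<sigma> A B) = B \<odot> A"
  using swap_hom[OF assms] by (auto simp: hom_iff)

lemma assoc_typ [simp]:
  assumes "A \<in> Ob C" "B \<in> Ob C" "D \<in> Ob C"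
  shows "\<alpha> A B D \<in> Ar C" "src C (\<alpha> A B D) = A \<odot> (B \<odot> D)" "trg C (\<alpha> A B D) = (A \<odot> B) \<odot> D"
    and "\<beta> A B D \<in> Ar C" "src C (\<beta> A B D) = (A \<odot> B) \<odot> D" "trg C (\<beta> A B D) = A \<odot> (B \<odot> D)"
  using assoc_iso[OF assms] assoc_inv_props[OF assms] by (auto simp: is_iso_def hom_iff)

lemma assoc_cancel [simp]:
  assumes "A \<in> Ob C" "B \<in> Ob C" "D \<in> Ob C"
  shows "\<beta> A B D \<cdot> \<alpha> A B D = \<iota> (A \<odot> (B \<odot> D))" "\<alpha> A B D \<cdot> \<beta> A B D = \<iota> ((A \<odot> B) \<odot> D)"
  using assoc_inv_props[OF assms] by auto

lemma assoc_cancel_tail [simp]: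
  assumes "A \<in> Ob C" "B \<in> Ob C" "D \<in> Ob C" "f \<in> Ar C"
  shows "trg C f = A \<odot> (B \<odot> D) \<Longrightarrow> \<beta> A B D \<cdot> (\<alpha> A B D \<cdot> f) = f"
    and "trg C f = (A \<odot> B) \<odot> D \<Longrightarrow> \<alpha> A B D \<cdot> (\<beta> A B D \<cdot> f) = f"
  using assms by (simp_all add: cmp_subst_left[OF assoc_cancel(1)] cmp_subst_left[OF assoc_cancel(2)])

lemma assoc_nat:
  assumes "f \<in> Ar C" "g \<in> Ar C" "h \<in> Ar C"
    "src C f = A" "src C g = B" "src C h = D" "trg C f = A'" "trg C g = B'" "trg C h = D'"
  shows "\<alpha> A' B' D' \<cdot> (f \<otimes> (g \<otimes> h)) = ((f \<otimes> g) \<otimes> h) \<cdot> \<alpha> A B D"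
  using assoc_natural[of f A A' g B B' h D D'] assms by (simp add: hom_iff)

lemma assoc_inv_nat:
  assumes "f \<in> Ar C" "g \<in> Ar C" "h \<in> Ar C"
    "src C f = A" "src C g = B" "src C h = D" "trg C f = A'" "trg C g = B'" "trg C h = D'"
  shows "\<beta> A' B' D' \<cdot> ((f \<otimes> g) \<otimes> h) = (f \<otimes> (g \<otimes> h)) \<cdot> \<beta> A B D"
proof -
  have Ob: "A \<in> Ob C" "B \<in> Ob C" "D \<in> Ob C" "A' \<in> Ob C" "B' \<in> Ob C" "D' \<in> Ob C"
    using assms by auto
  have "\<beta> A' B' D' \<cdot> ((f \<otimes> g) \<otimes> h) = \<beta> A' B' D' \<cdot> ((((f \<otimes> g) \<otimes> h) \<cdot> \<alpha> A B D) \<cdot> \<beta> A B D)"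
    using assms Ob by (simp add: cmp_reassoc)
  also have "\<dots> = \<beta> A' B' D' \<cdot> ((\<alpha> A' B' D' \<cdot> (f \<otimes> (g \<otimes> h))) \<cdot> \<beta> A B D)"
    by (simp only: assoc_nat[OF assms])
  also have "\<dots> = (f \<otimes> (g \<otimes> h)) \<cdot> \<beta> A B D"
    using assms Ob by (simp add: cmp_reassoc)
  finally show ?thesis .
qed

lemma lunit_nat: "\<lbrakk>f \<in> Ar C; src C f = A; trg C f = B\<rbrakk> \<Longrightarrow> \<ell> B \<cdot> (\<iota> \<I> \<otimes> f) = f \<cdot> \<ell> A"
  using lunit_natural[of f A B] by (simp add: hom_iff)

lemma runit_nat: "\<lbrakk>f \<in> Ar C; src C f = A; trg C f = B\<rbrakk> \<Longrightarrow> \<rho> B \<cdot> (f \<otimes> \<iota> \<I>) = f \<cdot> \<rho> A"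
  using runit_natural[of f A B] by (simp add: hom_iff)

lemma swap_nat:
  "\<lbrakk>f \<in> Ar C; g \<in> Ar C; src C f = A; trg C f = B; src C g = D; trg C g = E\<rbrakk>
    \<Longrightarrow> \<sigma> B E \<cdot> (f \<otimes> g) = (g \<otimes> f) \<cdot> \<sigma> A D"
  using swap_natural[of f A B g D E] by (simp add: hom_iff)

lemma tensor_ident_cmp:
  assumes "A \<in> Ob C" "f \<in> Ar C" "g \<in> Ar C" "trg C f = src C g"
  shows "\<iota> A \<otimes> (g \<cdot> f) = (\<iota> A \<otimes> g) \<cdot> (\<iota> A \<otimes> f)" "(g \<cdot> f) \<otimes> \<iota> A = (g \<otimes> \<iota> A) \<cdot> (f \<otimes> \<iota> A)"
  using assms by (simp_all add: tensor_interchange)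

lemma cmp_lunit_cancel:
  assumes "f \<cdot> \<ell> A = g \<cdot> \<ell> A" "A \<in> Ob C" "f \<in> Ar C" "g \<in> Ar C" "src C f = A" "src C g = A"
  shows "f = g"
proof -
  obtain k where k: "k \<in> Ar C" "src C k = A" "trg C k = \<I> \<odot> A" "\<ell> A \<cdot> k = \<iota> A"
    using lunit_iso[OF assms(2)] by (auto simp: is_iso_def hom_iff)
  have "(f \<cdot> \<ell> A) \<cdot> k = (g \<cdot> \<ell> A) \<cdot> k" by (simp only: assms(1))
  then show ?thesis using assms(2-) k by (simp add: cmp_reassoc)
qed

lemma assoc_cmp_cancel:
  assumes "\<alpha> A B D \<cdot> f = \<alpha> A B D \<cdot> g" "A \<in> Ob C" "B \<in> Ob C" "D \<in> Ob C"
    "f \<in> Ar C" "g \<in> Ar C" "trg C f = A \<odot> (B \<odot> D)" "trg C g = A \<odot> (B \<odot> D)"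
  shows "f = g"
proof -
  have "\<beta> A B D \<cdot> (\<alpha> A B D \<cdot> f) = \<beta> A B D \<cdot> (\<alpha> A B D \<cdot> g)" by (simp only: assms(1))
  then show ?thesis using assms(2-) by simp
qed

lemma pentagon':
  assumes "A \<in> Ob C" "B \<in> Ob C" "D \<in> Ob C" "E \<in> Ob C"
  shows "(\<alpha> A B D \<otimes> \<iota> E) \<cdot> (\<alpha> A (B \<odot> D) E \<cdot> (\<iota> A \<otimes> \<alpha> B D E)) = \<alpha> (A \<odot> B) D E \<cdot> \<alpha> A B (D \<odot> E)"
  using pentagon[OF assms] assms by (simp add: cmp_reassoc)

text \<open>Kelly's coherence law: the triangle axiom only covers a unit in the middle.\<close>

lemma lunit_tensor:
  assumes [simp]: "A \<in> Ob C" "B \<in> Ob C"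
  shows "(\<ell> A \<otimes> \<iota> B) \<cdot> \<alpha> \<I> A B = \<ell> (A \<odot> B)"
proof -
  let ?k = "(\<ell> A \<otimes> \<iota> B) \<cdot> \<alpha> \<I> A B"
  \<comment> \<open>The law is first proved with an extra unit tensored on the left and an
    associator composed in front. There the pentagon applies, and the unit that has to be removed
    stands in the middle, as the triangle requires.\<close>
  have "\<alpha> \<I> A B \<cdot> (\<iota> \<I> \<otimes> ?k) = (\<alpha> \<I> A B \<cdot> (\<iota> \<I> \<otimes> (\<ell> A \<otimes> \<iota> B))) \<cdot> (\<iota> \<I> \<otimes> \<alpha> \<I> A B)"
    by (simp add: tensor_ident_cmp cmp_reassoc)
  also have "\<dots> = (((\<iota> \<I> \<otimes> \<ell> A) \<otimes> \<iota> B) \<cdot> \<alpha> \<I> (\<I> \<odot> A) B) \<cdot> (\<iota> \<I> \<otimes> \<alpha> \<I> A B)"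
    by (simp add: assoc_nat[where A="\<I>" and B="\<I> \<odot> A" and D=B])
  also have "\<dots> = ((\<rho> \<I> \<otimes> \<iota> A) \<otimes> \<iota> B) \<cdot> ((\<alpha> \<I> \<I> A \<otimes> \<iota> B) \<cdot> (\<alpha> \<I> (\<I> \<odot> A) B \<cdot> (\<iota> \<I> \<otimes> \<alpha> \<I> A B)))"
    by (simp add: triangle[symmetric] tensor_ident_cmp cmp_reassoc)
  also have "\<dots> = (((\<rho> \<I> \<otimes> \<iota> A) \<otimes> \<iota> B) \<cdot> \<alpha> (\<I> \<odot> \<I>) A B) \<cdot> \<alpha> \<I> \<I> (A \<odot> B)"
    by (simp add: pentagon' cmp_reassoc)
  also have "\<dots> = (\<alpha> \<I> A B \<cdot> (\<rho> \<I> \<otimes> (\<iota> A \<otimes> \<iota> B))) \<cdot> \<alpha> \<I> \<I> (A \<odot> B)"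
    by (subst assoc_nat[where A="\<I> \<odot> \<I>" and B=A and D=B]) simp_all
  also have "\<dots> = \<alpha> \<I> A B \<cdot> (\<iota> \<I> \<otimes> \<ell> (A \<odot> B))"
    by (simp add: triangle[symmetric] cmp_reassoc)
  finally have "\<iota> \<I> \<otimes> ?k = \<iota> \<I> \<otimes> \<ell> (A \<odot> B)"
    by (rule assoc_cmp_cancel) simp_all
  \<comment> \<open>Naturality of \<ell> moves both maps out of the tensor with \<I>; the remaining
    \<ell> cancels because it is invertible.\<close>
  then have "\<ell> (A \<odot> B) \<cdot> (\<iota> \<I> \<otimes> ?k) = \<ell> (A \<odot> B) \<cdot> (\<iota> \<I> \<otimes> \<ell> (A \<odot> B))"
    by simp
  then have "?k \<cdot> \<ell> (\<I> \<odot> (A \<odot> B)) = \<ell> (A \<odot> B) \<cdot> \<ell> (\<I> \<odot> (A \<odot> B))"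
    by (simp add: lunit_nat[where A="\<I> \<odot> (A \<odot> B)"])
  then show ?thesis
    by (rule cmp_lunit_cancel) simp_all
qed

section \<open>Forms of the pentagon with inverse associators\<close>

lemma assoc_nat_left:
  assumes "f \<in> Ar C" "B \<in> Ob C" "D \<in> Ob C" "trg C f = A'"
  shows "\<alpha> A' B D \<cdot> (f \<otimes> \<iota> (B \<odot> D)) = ((f \<otimes> \<iota> B) \<otimes> \<iota> D) \<cdot> \<alpha> (src C f) B D"
  using assoc_nat[of f "\<iota> B" "\<iota> D" "src C f" B D A' B D] assms by simp

lemma assoc_nat_right:
  assumes "f \<in> Ar C" "A \<in> Ob C" "B \<in> Ob C" "trg C f = D'"
  shows "\<alpha> A B D' \<cdot> (\<iota> A \<otimes> (\<iota> B \<otimes> f)) = (\<iota> (A \<odot> B) \<otimes> f) \<cdot> \<alpha> A B (src C f)"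
  using assoc_nat[of "\<iota> A" "\<iota> B" f A B "src C f" A B D'] assms by simp

lemma assoc_inv_nat_left:
  assumes "f \<in> Ar C" "B \<in> Ob C" "D \<in> Ob C" "trg C f = A'"
  shows "\<beta> A' B D \<cdot> ((f \<otimes> \<iota> B) \<otimes> \<iota> D) = (f \<otimes> \<iota> (B \<odot> D)) \<cdot> \<beta> (src C f) B D"
  using assoc_inv_nat[of f "\<iota> B" "\<iota> D" "src C f" B D A' B D] assms by simp

lemma assoc_inv_nat_right:
  assumes "f \<in> Ar C" "A \<in> Ob C" "B \<in> Ob C" "trg C f = D'"
  shows "\<beta> A B D' \<cdot> (\<iota> (A \<odot> B) \<otimes> f) = (\<iota> A \<otimes> (\<iota> B \<otimes> f)) \<cdot> \<beta> A B (src C f)"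
  using assoc_inv_nat[of "\<iota> A" "\<iota> B" f A B "src C f" A B D'] assms by simp

lemma assoc_tensor_cancel:
  assumes [simp]: "A \<in> Ob C" "B \<in> Ob C" "D \<in> Ob C" "E \<in> Ob C"
  shows "(\<beta> A B D \<otimes> \<iota> E) \<cdot> (\<alpha> A B D \<otimes> \<iota> E) = \<iota> (A \<odot> (B \<odot> D) \<odot> E)"
    and "(\<alpha> A B D \<otimes> \<iota> E) \<cdot> (\<beta> A B D \<otimes> \<iota> E) = \<iota> (A \<odot> B \<odot> D \<odot> E)"
    and "(\<iota> E \<otimes> \<beta> A B D) \<cdot> (\<iota> E \<otimes> \<alpha> A B D) = \<iota> (E \<odot> (A \<odot> (B \<odot> D)))"
    and "(\<iota> E \<otimes> \<alpha> A B D) \<cdot> (\<iota> E \<otimes> \<beta> A B D) = \<iota> (E \<odot> (A \<odot> B \<odot> D))"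
  by (simp_all add: tensor_interchange)

lemmas assoc_tensor_cancel_tail = assoc_tensor_cancel[THEN cmp_subst_left]

text \<open>Inserting \<open>\<alpha> A B (D \<odot> E)\<close> and its inverse on the right exposes
  one side of the pentagon; the associator that it produces in front is then cancelled.\<close>

lemma pentagon_assoc_inv_left:
  assumes [simp]: "A \<in> Ob C" "B \<in> Ob C" "D \<in> Ob C" "E \<in> Ob C"
  shows "(\<beta> A B D \<otimes> \<iota> E) \<cdot> \<alpha> (A \<odot> B) D E
    = \<alpha> A (B \<odot> D) E \<cdot> ((\<iota> A \<otimes> \<alpha> B D E) \<cdot> \<beta> A B (D \<odot> E))"
proof -
  have "(\<beta> A B D \<otimes> \<iota> E) \<cdot> \<alpha> (A \<odot> B) D E
      = (\<beta> A B D \<otimes> \<iota> E) \<cdot> ((\<alpha> (A \<odot> B) D E \<cdot> \<alpha> A B (D \<odot> E)) \<cdot> \<beta> A B (D \<odot> E))"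
    by (simp add: cmp_reassoc)
  then show ?thesis
    by (simp add: pentagon'[symmetric] cmp_reassoc assoc_tensor_cancel_tail)
qed

lemma pentagon_assoc_inv:
  assumes [simp]: "A \<in> Ob C" "B \<in> Ob C" "D \<in> Ob C" "E \<in> Ob C"
  shows "\<beta> A B (D \<odot> E) \<cdot> \<beta> (A \<odot> B) D E
    = (\<iota> A \<otimes> \<beta> B D E) \<cdot> (\<beta> A (B \<odot> D) E \<cdot> (\<beta> A B D \<otimes> \<iota> E))"
proof -
  have "(\<iota> A \<otimes> \<beta> B D E) \<cdot> (\<beta> A (B \<odot> D) E \<cdot> (\<beta> A B D \<otimes> \<iota> E))
    = (\<iota> A \<otimes> \<beta> B D E) \<cdot> (\<beta> A (B \<odot> D) E \<cdot> (((\<beta> A B D \<otimes> \<iota> E) \<cdot> \<alpha> (A \<odot> B) D E) \<cdot> \<beta> (A \<odot> B) D E))"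
    by (simp add: cmp_reassoc)
  then show ?thesis
    by (simp add: pentagon_assoc_inv_left cmp_reassoc assoc_tensor_cancel_tail)
qed

section \<open>Transposing the first two factors of a right-nested product\<close>

definition transp ("\<tau>") where
  "\<tau> A B X = \<beta> B A X \<cdot> ((\<sigma> A B \<otimes> \<iota> X) \<cdot> \<alpha> A B X)"

lemma transp_typ [simp]:
  assumes "A \<in> Ob C" "B \<in> Ob C" "X \<in> Ob C"
  shows "\<tau> A B X \<in> Ar C" "src C (\<tau> A B X) = A \<odot> (B \<odot> X)" "trg C (\<tau> A B X) = B \<odot> (A \<odot> X)"
  using assms by (simp_all add: transp_def)

lemma transp_nat:
  assumes [simp]: "A \<in> Ob C" "B \<in> Ob C" "f \<in> Ar C" "trg C f = Y"
  shows "\<tau> A B Y \<cdot> (\<iota> A \<otimes> (\<iota> B \<otimes> f)) = (\<iota> B \<otimes> (\<iota> A \<otimes> f)) \<cdot> \<tau> A B (src C f)"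
proof -
  have [simp]: "Y \<in> Ob C" using src_trg_Ob(2)[OF assms(3)] by simp
  have "\<tau> A B Y \<cdot> (\<iota> A \<otimes> (\<iota> B \<otimes> f)) = \<beta> B A Y \<cdot> (((\<sigma> A B \<otimes> \<iota> Y) \<cdot> (\<iota> (A \<odot> B) \<otimes> f)) \<cdot> \<alpha> A B (src C f))"
    by (simp add: transp_def cmp_reassoc assoc_nat_right)
  also have "\<dots> = (\<beta> B A Y \<cdot> (\<iota> (B \<odot> A) \<otimes> f)) \<cdot> ((\<sigma> A B \<otimes> \<iota> (src C f)) \<cdot> \<alpha> A B (src C f))"
    by (simp add: tensor_interchange tensor_interchange_tail cmp_reassoc)
  also have "\<dots> = (\<iota> B \<otimes> (\<iota> A \<otimes> f)) \<cdot> \<tau> A B (src C f)"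
    by (simp add: assoc_inv_nat_right transp_def cmp_reassoc)
  finally show ?thesis .
qed

lemma transp_nat_left:
  assumes [simp]: "X \<in> Ob C" "B \<in> Ob C" "f \<in> Ar C" "trg C f = A'"
  shows "\<tau> A' B X \<cdot> (f \<otimes> \<iota> (B \<odot> X)) = (\<iota> B \<otimes> (f \<otimes> \<iota> X)) \<cdot> \<tau> (src C f) B X"
proof -
  have [simp]: "A' \<in> Ob C" using src_trg_Ob(2)[OF assms(3)] by simp
  have "\<tau> A' B X \<cdot> (f \<otimes> \<iota> (B \<odot> X)) = \<beta> B A' X \<cdot> (((\<sigma> A' B \<cdot> (f \<otimes> \<iota> B)) \<otimes> \<iota> X) \<cdot> \<alpha> (src C f) B X)"
    by (simp add: transp_def cmp_reassoc assoc_nat_left tensor_ident_cmp)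
  also have "\<dots> = (\<beta> B A' X \<cdot> ((\<iota> B \<otimes> f) \<otimes> \<iota> X)) \<cdot> ((\<sigma> (src C f) B \<otimes> \<iota> X) \<cdot> \<alpha> (src C f) B X)"
    by (simp add: swap_nat[where A="src C f" and D=B and B=A' and E=B] tensor_ident_cmp cmp_reassoc)
  also have "\<dots> = (\<iota> B \<otimes> (f \<otimes> \<iota> X)) \<cdot> \<tau> (src C f) B X"
    by (simp add: assoc_inv_nat[where A=B and B="src C f" and D=X] transp_def cmp_reassoc)
  finally show ?thesis .
qed

lemma transp_transp:
  assumes [simp]: "A \<in> Ob C" "B \<in> Ob C" "X \<in> Ob C"
  shows "\<tau> B A X \<cdot> \<tau> A B X = \<iota> (A \<odot> (B \<odot> X))"
  by (simp add: transp_def cmp_reassoc tensor_interchange_tail swap_swap)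

lemma tensor_transp_transp:
  assumes [simp]: "A \<in> Ob C" "B \<in> Ob C" "X \<in> Ob C" "D \<in> Ob C"
  shows "(\<iota> D \<otimes> \<tau> B A X) \<cdot> (\<iota> D \<otimes> \<tau> A B X) = \<iota> (D \<odot> (A \<odot> (B \<odot> X)))"
  by (simp add: tensor_interchange transp_transp)

text \<open>The pentagon is used twice, for the associator and for the inverse associator inside
  \<open>\<tau>\<close>; the symmetry between them passes by naturality.\<close>

lemma transp_tensor:
  assumes [simp]: "A \<in> Ob C" "B \<in> Ob C" "Y \<in> Ob C" "Z \<in> Ob C"
  shows "(\<tau> A B Z \<otimes> \<iota> Y) \<cdot> (\<alpha> A (B \<odot> Z) Y \<cdot> (\<iota> A \<otimes> \<alpha> B Z Y))
    = \<alpha> B (A \<odot> Z) Y \<cdot> ((\<iota> B \<otimes> \<alpha> A Z Y) \<cdot> \<tau> A B (Z \<odot> Y))"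
proof -
  have "(\<tau> A B Z \<otimes> \<iota> Y) \<cdot> (\<alpha> A (B \<odot> Z) Y \<cdot> (\<iota> A \<otimes> \<alpha> B Z Y))
    = (\<beta> B A Z \<otimes> \<iota> Y) \<cdot> ((((\<sigma> A B \<otimes> \<iota> Z) \<otimes> \<iota> Y) \<cdot> \<alpha> (A \<odot> B) Z Y) \<cdot> \<alpha> A B (Z \<odot> Y))"
    by (simp add: transp_def tensor_ident_cmp cmp_reassoc pentagon')
  also have "\<dots> = ((\<beta> B A Z \<otimes> \<iota> Y) \<cdot> \<alpha> (B \<odot> A) Z Y) \<cdot> ((\<sigma> A B \<otimes> \<iota> (Z \<odot> Y)) \<cdot> \<alpha> A B (Z \<odot> Y))"
    by (simp add: assoc_nat_left cmp_reassoc cmp_subst_left[OF assoc_nat_left])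
  also have "\<dots> = \<alpha> B (A \<odot> Z) Y \<cdot> ((\<iota> B \<otimes> \<alpha> A Z Y) \<cdot> \<tau> A B (Z \<odot> Y))"
    by (simp add: pentagon_assoc_inv_left transp_def cmp_reassoc)
  finally show ?thesis .
qed

text \<open>This is the hexagon with its outer associator moved across: \<open>D\<close> passes a
  product one factor at a time.\<close>

lemma swap_tensor_left:
  assumes [simp]: "A \<in> Ob C" "B \<in> Ob C" "D \<in> Ob C"
  shows "\<sigma> (A \<odot> B) D \<cdot> \<alpha> A B D = \<tau> A D B \<cdot> (\<iota> A \<otimes> \<sigma> B D)"
proof -
  have "\<sigma> (A \<odot> B) D \<cdot> \<alpha> A B D = \<beta> D A B \<cdot> (\<alpha> D A B \<cdot> \<sigma> (A \<odot> B) D \<cdot> \<alpha> A B D)"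
    by (simp add: cmp_reassoc)
  then show ?thesis
    unfolding hexagon[OF assms] by (simp add: transp_def cmp_reassoc)
qed

text \<open>The hexagon for transpositions: a product passes \<open>B\<close> by letting
  \<open>A'\<close> pass first and then \<open>A\<close>. It yields one compatibility of
  \<open>\<tau>\<close> with comultiplication.\<close>

lemma transp_tensor_left:
  assumes [simp]: "A \<in> Ob C" "A' \<in> Ob C" "B \<in> Ob C" "X \<in> Ob C"
  shows "(\<iota> B \<otimes> \<beta> A A' X) \<cdot> \<tau> (A \<odot> A') B X
    = \<tau> A B (A' \<odot> X) \<cdot> ((\<iota> A \<otimes> \<tau> A' B X) \<cdot> \<beta> A A' (B \<odot> X))"
proof -
  have \<sigma>: "\<sigma> (A \<odot> A') B = \<tau> A B A' \<cdot> ((\<iota> A \<otimes> \<sigma> A' B) \<cdot> \<beta> A A' B)"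
  proof -
    have "\<sigma> (A \<odot> A') B = (\<sigma> (A \<odot> A') B \<cdot> \<alpha> A A' B) \<cdot> \<beta> A A' B"
      by (simp add: cmp_reassoc)
    then show ?thesis by (simp add: swap_tensor_left cmp_reassoc)
  qed
  \<comment> \<open>The definition of \<open>\<tau>\<close> is read backwards, so that a symmetry
    tensored with \<open>X\<close> becomes a transposition between associators that cancel
    later.\<close>
  have \<tau>: "\<sigma> A' B \<otimes> \<iota> X = \<alpha> B A' X \<cdot> (\<tau> A' B X \<cdot> \<beta> A' B X)"
    by (simp add: transp_def cmp_reassoc)
  have "(\<iota> B \<otimes> \<beta> A A' X) \<cdot> \<tau> (A \<odot> A') B X
    = (\<iota> B \<otimes> \<beta> A A' X) \<cdot> (\<beta> B (A \<odot> A') X \<cdot> ((\<tau> A B A' \<otimes> \<iota> X) \<cdot> (((\<iota> A \<otimes> \<sigma> A' B) \<otimes> \<iota> X) \<cdot>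
        ((\<beta> A A' B \<otimes> \<iota> X) \<cdot> \<alpha> (A \<odot> A') B X))))"
    by (simp add: transp_def[of "A \<odot> A'"] \<sigma> tensor_ident_cmp cmp_reassoc)
  also have "\<dots> = (\<iota> B \<otimes> \<beta> A A' X) \<cdot> (\<beta> B (A \<odot> A') X \<cdot> ((\<tau> A B A' \<otimes> \<iota> X) \<cdot>
        ((((\<iota> A \<otimes> \<sigma> A' B) \<otimes> \<iota> X) \<cdot> \<alpha> A (A' \<odot> B) X) \<cdot> ((\<iota> A \<otimes> \<alpha> A' B X) \<cdot> \<beta> A A' (B \<odot> X)))))"
    by (simp add: pentagon_assoc_inv_left cmp_reassoc)
  also have "\<dots> = (\<iota> B \<otimes> \<beta> A A' X) \<cdot> (\<beta> B (A \<odot> A') X \<cdot> ((\<tau> A B A' \<otimes> \<iota> X) \<cdot>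
        ((\<alpha> A (B \<odot> A') X \<cdot> (\<iota> A \<otimes> (\<sigma> A' B \<otimes> \<iota> X))) \<cdot> ((\<iota> A \<otimes> \<alpha> A' B X) \<cdot> \<beta> A A' (B \<odot> X)))))"
    by (simp add: assoc_nat[where A=A and B="A' \<odot> B" and D=X])
  also have "\<dots> = (\<iota> B \<otimes> \<beta> A A' X) \<cdot> (\<beta> B (A \<odot> A') X \<cdot> ((\<tau> A B A' \<otimes> \<iota> X) \<cdot>
        (\<alpha> A (B \<odot> A') X \<cdot> ((\<iota> A \<otimes> \<alpha> B A' X) \<cdot> ((\<iota> A \<otimes> \<tau> A' B X) \<cdot> \<beta> A A' (B \<odot> X))))))"
    by (simp add: \<tau> tensor_ident_cmp cmp_reassoc assoc_tensor_cancel_tail)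
  also have "\<dots> = \<tau> A B (A' \<odot> X) \<cdot> ((\<iota> A \<otimes> \<tau> A' B X) \<cdot> \<beta> A A' (B \<odot> X))"
    by (simp add: cmp_subst_left3[OF transp_tensor] cmp_reassoc assoc_tensor_cancel_tail)
  finally show ?thesis .
qed

text \<open>The mirror image of \<open>transp_tensor_left\<close>, obtained by inverting every map
  in it: the inverse of a transposition is the transposition with its first two indices
  exchanged.\<close>

lemma transp_tensor_right:
  assumes [simp]: "A \<in> Ob C" "A' \<in> Ob C" "B \<in> Ob C" "X \<in> Ob C"
  shows "\<tau> B (A \<odot> A') X \<cdot> (\<iota> B \<otimes> \<alpha> A A' X)
    = \<alpha> A A' (B \<odot> X) \<cdot> ((\<iota> A \<otimes> \<tau> B A' X) \<cdot> \<tau> B A (A' \<odot> X))"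
proof -
  have "\<alpha> A A' (B \<odot> X) \<cdot> ((\<iota> A \<otimes> \<tau> B A' X) \<cdot> \<tau> B A (A' \<odot> X))
    = \<alpha> A A' (B \<odot> X) \<cdot> ((\<iota> A \<otimes> \<tau> B A' X) \<cdot> (\<tau> B A (A' \<odot> X) \<cdot>
        (((\<iota> B \<otimes> \<beta> A A' X) \<cdot> \<tau> (A \<odot> A') B X) \<cdot> (\<tau> B (A \<odot> A') X \<cdot> (\<iota> B \<otimes> \<alpha> A A' X)))))"
    by (simp add: cmp_reassoc cmp_subst_left[OF transp_transp] assoc_tensor_cancel)
  then show ?thesis
    by (simp add: transp_tensor_left cmp_reassoc cmp_subst_left[OF transp_transp]
        cmp_subst_left[OF tensor_transp_transp])
qed

text \<open>Likewise the inverse of \<open>swap_tensor_left\<close>.\<close>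

lemma swap_tensor_right:
  assumes [simp]: "A \<in> Ob C" "A' \<in> Ob C" "B \<in> Ob C"
  shows "\<sigma> B (A \<odot> A') = \<alpha> A A' B \<cdot> ((\<iota> A \<otimes> \<sigma> B A') \<cdot> \<tau> B A A')"
proof -
  have "\<alpha> A A' B \<cdot> ((\<iota> A \<otimes> \<sigma> B A') \<cdot> \<tau> B A A')
    = \<alpha> A A' B \<cdot> ((\<iota> A \<otimes> \<sigma> B A') \<cdot> (\<tau> B A A' \<cdot>
        ((\<sigma> (A \<odot> A') B \<cdot> \<alpha> A A' B) \<cdot> (\<beta> A A' B \<cdot> \<sigma> B (A \<odot> A')))))"
    by (simp add: cmp_reassoc swap_swap)
  then show ?thesis
    by (simp add: swap_tensor_left cmp_reassoc cmp_subst_left[OF transp_transp]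
        tensor_interchange_tail swap_swap)
qed

section \<open>Comonoids as comonads, and their interaction with transpositions\<close>

text \<open>
  A comonoid structure on \<open>A\<close> is handled through the comonad \<open>X \<mapsto> A \<odot> X\<close> that it induces, because
  composition of functors is strictly associative.
\<close>

definition coact ("\<delta>") where
  "\<delta> d X = \<beta> (src C d) (src C d) X \<cdot> (d \<otimes> \<iota> X)"

definition discard ("\<theta>") where
  "\<theta> e X = \<ell> X \<cdot> (e \<otimes> \<iota> X)"

lemma coact_typ [simp]:
  assumes "d \<in> Ar C" "trg C d = src C d \<odot> src C d" "X \<in> Ob C"
  shows "\<delta> d X \<in> Ar C" "src C (\<delta> d X) = src C d \<odot> X" "trg C (\<delta> d X) = src C d \<odot> (src C d \<odot> X)"
  using assms by (simp_all add: coact_def)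

lemma discard_typ [simp]:
  assumes "e \<in> Ar C" "trg C e = \<I>" "X \<in> Ob C"
  shows "\<theta> e X \<in> Ar C" "src C (\<theta> e X) = src C e \<odot> X" "trg C (\<theta> e X) = X"
  using assms by (simp_all add: discard_def)

lemma coact_nat:
  assumes [simp]: "d \<in> Ar C" "src C d = A" "trg C d = A \<odot> A" "f \<in> Ar C" "trg C f = Y"
  shows "\<delta> d Y \<cdot> (\<iota> A \<otimes> f) = (\<iota> A \<otimes> (\<iota> A \<otimes> f)) \<cdot> \<delta> d (src C f)"
proof -
  have [simp]: "A \<in> Ob C" "Y \<in> Ob C"
    using src_trg_Ob(1)[OF assms(1)] src_trg_Ob(2)[OF assms(4)] by simp_all
  have "\<delta> d Y \<cdot> (\<iota> A \<otimes> f) = (\<beta> A A Y \<cdot> (\<iota> (A \<odot> A) \<otimes> f)) \<cdot> (d \<otimes> \<iota> (src C f))"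
    by (simp add: coact_def cmp_reassoc tensor_interchange)
  then show ?thesis
    by (simp add: assoc_inv_nat_right coact_def cmp_reassoc)
qed

lemma discard_nat:
  assumes [simp]: "e \<in> Ar C" "src C e = A" "trg C e = \<I>" "f \<in> Ar C" "trg C f = Y"
  shows "\<theta> e Y \<cdot> (\<iota> A \<otimes> f) = f \<cdot> \<theta> e (src C f)"
proof -
  have [simp]: "A \<in> Ob C" "Y \<in> Ob C"
    using src_trg_Ob(1)[OF assms(1)] src_trg_Ob(2)[OF assms(4)] by simp_all
  have "\<theta> e Y \<cdot> (\<iota> A \<otimes> f) = (\<ell> Y \<cdot> (\<iota> \<I> \<otimes> f)) \<cdot> (e \<otimes> \<iota> (src C f))"
    by (simp add: discard_def cmp_reassoc tensor_interchange)
  then show ?thesis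
    by (simp add: lunit_nat[of f, OF _ refl] discard_def cmp_reassoc)
qed

lemma coact_tensor:
  assumes [simp]: "d \<in> Ar C" "src C d = A" "trg C d = A \<odot> A" "Z \<in> Ob C" "Y \<in> Ob C"
  shows "(\<delta> d Z \<otimes> \<iota> Y) \<cdot> \<alpha> A Z Y = \<alpha> A (A \<odot> Z) Y \<cdot> ((\<iota> A \<otimes> \<alpha> A Z Y) \<cdot> \<delta> d (Z \<odot> Y))"
proof -
  have [simp]: "A \<in> Ob C" using src_trg_Ob(1)[OF assms(1)] by simp
  have "(\<delta> d Z \<otimes> \<iota> Y) \<cdot> \<alpha> A Z Y = (\<beta> A A Z \<otimes> \<iota> Y) \<cdot> (((d \<otimes> \<iota> Z) \<otimes> \<iota> Y) \<cdot> \<alpha> A Z Y)"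
    by (simp add: coact_def tensor_ident_cmp cmp_reassoc)
  also have "\<dots> = ((\<beta> A A Z \<otimes> \<iota> Y) \<cdot> \<alpha> (A \<odot> A) Z Y) \<cdot> (d \<otimes> \<iota> (Z \<odot> Y))"
    by (simp add: assoc_nat_left cmp_reassoc)
  also have "\<dots> = \<alpha> A (A \<odot> Z) Y \<cdot> ((\<iota> A \<otimes> \<alpha> A Z Y) \<cdot> \<delta> d (Z \<odot> Y))"
    by (simp add: pentagon_assoc_inv_left coact_def cmp_reassoc)
  finally show ?thesis .
qed

text \<open>First comultiplication axiom of the distributive law. The map \<open>d\<close> slides
  through \<open>\<tau>\<close> by naturality, and the product \<open>A \<odot> A\<close> that it
  creates is split by \<open>transp_tensor_left\<close>.\<close>

lemma transp_coact:
  assumes [simp]: "d \<in> Ar C" "src C d = A" "trg C d = A \<odot> A" "B \<in> Ob C" "X \<in> Ob C"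
  shows "(\<iota> B \<otimes> \<delta> d X) \<cdot> \<tau> A B X = \<tau> A B (A \<odot> X) \<cdot> ((\<iota> A \<otimes> \<tau> A B X) \<cdot> \<delta> d (B \<odot> X))"
proof -
  have [simp]: "A \<in> Ob C" using src_trg_Ob(1)[OF assms(1)] by simp
  have "(\<iota> B \<otimes> \<delta> d X) \<cdot> \<tau> A B X = (\<iota> B \<otimes> \<beta> A A X) \<cdot> ((\<iota> B \<otimes> (d \<otimes> \<iota> X)) \<cdot> \<tau> A B X)"
    by (simp add: coact_def tensor_ident_cmp cmp_reassoc)
  also have "\<dots> = ((\<iota> B \<otimes> \<beta> A A X) \<cdot> \<tau> (A \<odot> A) B X) \<cdot> (d \<otimes> \<iota> (B \<odot> X))"
    by (simp add: transp_nat_left cmp_reassoc)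
  also have "\<dots> = \<tau> A B (A \<odot> X) \<cdot> ((\<iota> A \<otimes> \<tau> A B X) \<cdot> \<delta> d (B \<odot> X))"
    by (simp add: transp_tensor_left coact_def cmp_reassoc)
  finally show ?thesis .
qed

text \<open>Second comultiplication axiom, deduced from the first with the roles of \<open>A\<close>
  and \<open>B\<close> exchanged, since \<open>\<tau> A B X\<close> and \<open>\<tau> B A X\<close>
  are inverse to each other.\<close>

lemma coact_transp:
  assumes [simp]: "d \<in> Ar C" "src C d = B" "trg C d = B \<odot> B" "A \<in> Ob C" "X \<in> Ob C"
  shows "\<delta> d (A \<odot> X) \<cdot> \<tau> A B X = (\<iota> B \<otimes> \<tau> A B X) \<cdot> (\<tau> A B (B \<odot> X) \<cdot> (\<iota> A \<otimes> \<delta> d X))"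
proof -
  have [simp]: "B \<in> Ob C" using src_trg_Ob(1)[OF assms(1)] by simp
  have "(\<iota> B \<otimes> \<tau> A B X) \<cdot> (\<tau> A B (B \<odot> X) \<cdot> (\<iota> A \<otimes> \<delta> d X))
    = (\<iota> B \<otimes> \<tau> A B X) \<cdot> (\<tau> A B (B \<odot> X) \<cdot> (((\<iota> A \<otimes> \<delta> d X) \<cdot> \<tau> B A X) \<cdot> \<tau> A B X))"
    by (simp add: cmp_reassoc transp_transp)
  also have "\<dots> = \<delta> d (A \<odot> X) \<cdot> \<tau> A B X"
    by (simp add: transp_coact cmp_reassoc cmp_subst_left[OF transp_transp]
        cmp_subst_left[OF tensor_transp_transp])
  finally show ?thesis ..
qed

text \<open>A counit axiom of the distributive law. Naturality carries \<open>e\<close> through the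
  symmetry; what remains is a symmetry with \<I>, which \<open>swap_unit\<close> turns into \<rho>,
  and then the triangle applies. Kelly's law for \<ell> is needed to reach that form.\<close>

lemma discard_transp:
  assumes [simp]: "e \<in> Ar C" "src C e = B" "trg C e = \<I>" "A \<in> Ob C" "X \<in> Ob C"
  shows "\<theta> e (A \<odot> X) \<cdot> \<tau> A B X = \<iota> A \<otimes> \<theta> e X"
proof -
  have [simp]: "B \<in> Ob C" using src_trg_Ob(1)[OF assms(1)] by simp
  have "\<theta> e (A \<odot> X) \<cdot> \<tau> A B X
    = \<ell> (A \<odot> X) \<cdot> (((e \<otimes> \<iota> (A \<odot> X)) \<cdot> \<beta> B A X) \<cdot> ((\<sigma> A B \<otimes> \<iota> X) \<cdot> \<alpha> A B X))"
    by (simp add: discard_def transp_def cmp_reassoc)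
  also have "\<dots> = (\<ell> (A \<odot> X) \<cdot> \<beta> \<I> A X) \<cdot> ((((e \<otimes> \<iota> A) \<cdot> \<sigma> A B) \<otimes> \<iota> X) \<cdot> \<alpha> A B X)"
    by (simp add: cmp_reassoc tensor_ident_cmp cmp_subst_left[OF assoc_inv_nat_left])
  also have "\<dots> = (\<ell> A \<otimes> \<iota> X) \<cdot> (((\<sigma> A \<I> \<cdot> (\<iota> A \<otimes> e)) \<otimes> \<iota> X) \<cdot> \<alpha> A B X)"
    by (simp add: lunit_tensor[symmetric] swap_nat[of "\<iota> A" e, OF _ _ refl _ refl] cmp_reassoc)
  also have "\<dots> = ((\<ell> A \<cdot> \<sigma> A \<I>) \<otimes> \<iota> X) \<cdot> (((\<iota> A \<otimes> e) \<otimes> \<iota> X) \<cdot> \<alpha> A B X)"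
    by (simp add: tensor_ident_cmp cmp_reassoc)
  also have "\<dots> = ((\<rho> A \<otimes> \<iota> X) \<cdot> \<alpha> A \<I> X) \<cdot> (\<iota> A \<otimes> (e \<otimes> \<iota> X))"
    by (simp add: swap_unit cmp_reassoc assoc_nat[where A=A and B=B and D=X])
  also have "\<dots> = \<iota> A \<otimes> \<theta> e X"
    by (simp add: triangle discard_def tensor_interchange)
  finally show ?thesis .
qed

lemma discard_discard:
  assumes [simp]: "e \<in> Ar C" "src C e = A" "trg C e = \<I>" "e' \<in> Ar C" "src C e' = B" "trg C e' = \<I>" "Y \<in> Ob C"
  shows "\<theta> (e' \<cdot> \<theta> e B) Y \<cdot> \<alpha> A B Y = \<theta> e' Y \<cdot> \<theta> e (B \<odot> Y)"
proof -
  have [simp]: "A \<in> Ob C" "B \<in> Ob C"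
    using src_trg_Ob(1)[OF assms(1)] src_trg_Ob(1)[OF assms(4)] by simp_all
  have "\<theta> (e' \<cdot> \<theta> e B) Y \<cdot> \<alpha> A B Y = \<theta> e' Y \<cdot> ((\<ell> B \<otimes> \<iota> Y) \<cdot> (((e \<otimes> \<iota> B) \<otimes> \<iota> Y) \<cdot> \<alpha> A B Y))"
    by (simp add: discard_def tensor_ident_cmp cmp_reassoc)
  also have "\<dots> = \<theta> e' Y \<cdot> (((\<ell> B \<otimes> \<iota> Y) \<cdot> \<alpha> \<I> B Y) \<cdot> (e \<otimes> \<iota> (B \<odot> Y)))"
    by (simp add: assoc_nat_left cmp_reassoc)
  also have "\<dots> = \<theta> e' Y \<cdot> \<theta> e (B \<odot> Y)"
    by (simp add: lunit_tensor discard_def)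
  finally show ?thesis .
qed

lemma comonoid_typ:
  assumes "cocommutative_comonoid C A d e"
  shows "d \<in> Ar C" "src C d = A" "trg C d = A \<odot> A" "e \<in> Ar C" "src C e = A" "trg C e = \<I>" "A \<in> Ob C"
  using assms src_trg_Ob by (auto simp: cocommutative_comonoid_def hom_iff)

lemma comonoid_laws:
  assumes "cocommutative_comonoid C A d e"
  shows "\<delta> d A \<cdot> d = (\<iota> A \<otimes> d) \<cdot> d" "\<theta> e A \<cdot> d = \<iota> A"
    "\<rho> A \<cdot> ((\<iota> A \<otimes> e) \<cdot> d) = \<iota> A" "\<sigma> A A \<cdot> d = d"
proof -
  note [simp] = comonoid_typ[OF assms]
  have 1: "(d \<otimes> \<iota> A) \<cdot> d = \<alpha> A A A \<cdot> ((\<iota> A \<otimes> d) \<cdot> d)"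
    and 2: "\<theta> e A \<cdot> d = \<iota> A" and 3: "\<rho> A \<cdot> ((\<iota> A \<otimes> e) \<cdot> d) = \<iota> A" and 4: "\<sigma> A A \<cdot> d = d"
    using assms by (auto simp: cocommutative_comonoid_def discard_def cmp_reassoc)
  show "\<delta> d A \<cdot> d = (\<iota> A \<otimes> d) \<cdot> d" by (simp add: coact_def cmp_reassoc 1)
  show "\<theta> e A \<cdot> d = \<iota> A" "\<rho> A \<cdot> ((\<iota> A \<otimes> e) \<cdot> d) = \<iota> A" "\<sigma> A A \<cdot> d = d" by fact+
qed

text \<open>The comonad laws of X \<mapsto> A \<odot> X. Coassociativity comes from the pentagon,
  the first counit law from Kelly's law and the second from the triangle, each combined with the
  corresponding comonoid law.\<close>

lemma comonoid_coact:
  assumes "cocommutative_comonoid C A d e" and [simp]: "X \<in> Ob C"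
  shows coact_coact: "\<delta> d (A \<odot> X) \<cdot> \<delta> d X = (\<iota> A \<otimes> \<delta> d X) \<cdot> \<delta> d X"
    and discard_coact: "\<theta> e (A \<odot> X) \<cdot> \<delta> d X = \<iota> (A \<odot> X)"
    and tensor_discard_coact: "(\<iota> A \<otimes> \<theta> e X) \<cdot> \<delta> d X = \<iota> (A \<odot> X)"
proof -
  note [simp] = comonoid_typ[OF assms(1)]
  note laws = comonoid_laws[OF assms(1)]
  have "\<delta> d (A \<odot> X) \<cdot> \<delta> d X = \<beta> A A (A \<odot> X) \<cdot> (((d \<otimes> \<iota> (A \<odot> X)) \<cdot> \<beta> A A X) \<cdot> (d \<otimes> \<iota> X))"
    by (simp add: coact_def cmp_reassoc)
  also have "\<dots> = (\<beta> A A (A \<odot> X) \<cdot> \<beta> (A \<odot> A) A X) \<cdot> (((d \<otimes> \<iota> A) \<otimes> \<iota> X) \<cdot> (d \<otimes> \<iota> X))"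
    by (simp add: cmp_reassoc cmp_subst_left[OF assoc_inv_nat_left])
  also have "\<dots> = (\<iota> A \<otimes> \<beta> A A X) \<cdot> (\<beta> A (A \<odot> A) X \<cdot> ((\<delta> d A \<cdot> d) \<otimes> \<iota> X))"
    by (simp add: pentagon_assoc_inv coact_def cmp_reassoc tensor_ident_cmp)
  also have "\<dots> = (\<iota> A \<otimes> \<beta> A A X) \<cdot> ((\<beta> A (A \<odot> A) X \<cdot> ((\<iota> A \<otimes> d) \<otimes> \<iota> X)) \<cdot> (d \<otimes> \<iota> X))"
    by (simp add: laws cmp_reassoc tensor_ident_cmp)
  also have "\<dots> = (\<iota> A \<otimes> \<delta> d X) \<cdot> \<delta> d X"
    by (simp add: assoc_inv_nat[where A=A and B=A and D=X] coact_def cmp_reassoc tensor_ident_cmp)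
  finally show "\<delta> d (A \<odot> X) \<cdot> \<delta> d X = (\<iota> A \<otimes> \<delta> d X) \<cdot> \<delta> d X" .
  have "\<theta> e (A \<odot> X) \<cdot> \<delta> d X = \<ell> (A \<odot> X) \<cdot> (((e \<otimes> \<iota> (A \<odot> X)) \<cdot> \<beta> A A X) \<cdot> (d \<otimes> \<iota> X))"
    by (simp add: coact_def discard_def cmp_reassoc)
  also have "\<dots> = (\<ell> (A \<odot> X) \<cdot> \<beta> \<I> A X) \<cdot> (((e \<otimes> \<iota> A) \<otimes> \<iota> X) \<cdot> (d \<otimes> \<iota> X))"
    by (simp add: cmp_reassoc cmp_subst_left[OF assoc_inv_nat_left])
  also have "\<dots> = (\<theta> e A \<cdot> d) \<otimes> \<iota> X"
    by (simp add: lunit_tensor[symmetric] discard_def cmp_reassoc tensor_ident_cmp)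
  finally show "\<theta> e (A \<odot> X) \<cdot> \<delta> d X = \<iota> (A \<odot> X)"
    by (simp add: laws)
  have "(\<iota> A \<otimes> \<theta> e X) \<cdot> \<delta> d X = (\<rho> A \<otimes> \<iota> X) \<cdot> ((\<alpha> A \<I> X \<cdot> (\<iota> A \<otimes> (e \<otimes> \<iota> X))) \<cdot> (\<beta> A A X \<cdot> (d \<otimes> \<iota> X)))"
    by (simp add: coact_def discard_def tensor_ident_cmp cmp_reassoc triangle[symmetric])
  also have "\<dots> = (\<rho> A \<cdot> ((\<iota> A \<otimes> e) \<cdot> d)) \<otimes> \<iota> X"
    by (simp add: assoc_nat[where A=A and B=A and D=X] tensor_ident_cmp cmp_reassoc)
  finally show "(\<iota> A \<otimes> \<theta> e X) \<cdot> \<delta> d X = \<iota> (A \<odot> X)"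
    by (simp add: laws)
qed

end

section \<open>Tensor products of comonoids\<close>

locale comonoid_pair = locally_posetal_symmetric_monoidal C
  for C :: "('o, 'm, 'x) monoidal_cat_scheme" (structure) +
  fixes A d e B d' e'
  assumes comonoid_left: "cocommutative_comonoid C A d e"
    and comonoid_right: "cocommutative_comonoid C B d' e'"
begin

lemmas pair_typ [simp] = comonoid_typ[OF comonoid_left] comonoid_typ[OF comonoid_right]

lemmas left_laws = comonoid_laws[OF comonoid_left] and right_laws = comonoid_laws[OF comonoid_right]

text \<open>On elements: (a, b) goes to (a, (b, (a, b))). The right-nested target postpones all
  outer associators to \<open>tensor_dup\<close>.\<close>

definition "pair_dup = (\<iota> A \<otimes> \<tau> A B B) \<cdot> (\<delta> d (B \<odot> B) \<cdot> (\<iota> A \<otimes> d'))"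

text \<open>The comultiplication at \<open>Y\<close> of the composite comonad Y \<mapsto> A \<odot>
  (B \<odot> Y).\<close>

definition "pair_coact Y = (\<iota> A \<otimes> \<tau> A B (B \<odot> Y)) \<cdot> (\<delta> d (B \<odot> (B \<odot> Y)) \<cdot> (\<iota> A \<otimes> \<delta> d' Y))"

definition "tensor_dup = \<alpha> A B (A \<odot> B) \<cdot> pair_dup"

definition "tensor_discard = e' \<cdot> \<theta> e B"

lemma pair_dup_typ [simp]:
  "pair_dup \<in> Ar C" "src C pair_dup = A \<odot> B" "trg C pair_dup = A \<odot> (B \<odot> (A \<odot> B))"
  by (simp_all add: pair_dup_def)

lemma pair_coact_typ [simp]:
  assumes "Y \<in> Ob C"
  shows "pair_coact Y \<in> Ar C" "src C (pair_coact Y) = A \<odot> (B \<odot> Y)"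
    "trg C (pair_coact Y) = A \<odot> (B \<odot> (A \<odot> (B \<odot> Y)))"
  using assms by (simp_all add: pair_coact_def)

lemma tensor_dup_typ [simp]:
  "tensor_dup \<in> Ar C" "src C tensor_dup = A \<odot> B" "trg C tensor_dup = A \<odot> B \<odot> (A \<odot> B)"
  by (simp_all add: tensor_dup_def)

lemma tensor_discard_typ [simp]:
  "tensor_discard \<in> Ar C" "src C tensor_discard = A \<odot> B" "trg C tensor_discard = \<I>"
  by (simp_all add: tensor_discard_def)

text \<open>In coassociativity one side duplicates the left copy, which produces
  \<open>pair_dup \<otimes> \<iota> Y\<close>. Pushing the associator inwards through each of its
  three layers turns it into the comultiplication of the composite comonad.\<close>

lemma pair_dup_tensor:
  assumes [simp]: "Y \<in> Ob C"
  shows "(pair_dup \<otimes> \<iota> Y) \<cdot> \<alpha> A B Y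
    = \<alpha> A (B \<odot> (A \<odot> B)) Y \<cdot> ((\<iota> A \<otimes> \<alpha> B (A \<odot> B) Y) \<cdot> ((\<iota> A \<otimes> (\<iota> B \<otimes> \<alpha> A B Y)) \<cdot> pair_coact Y))"
proof -
  have "(pair_dup \<otimes> \<iota> Y) \<cdot> \<alpha> A B Y
    = ((\<iota> A \<otimes> \<tau> A B B) \<otimes> \<iota> Y) \<cdot> ((\<delta> d (B \<odot> B) \<otimes> \<iota> Y) \<cdot> (((\<iota> A \<otimes> d') \<otimes> \<iota> Y) \<cdot> \<alpha> A B Y))"
    by (simp add: pair_dup_def tensor_ident_cmp cmp_reassoc)
  also have "\<dots> = ((\<iota> A \<otimes> \<tau> A B B) \<otimes> \<iota> Y) \<cdot> (((\<delta> d (B \<odot> B) \<otimes> \<iota> Y) \<cdot> \<alpha> A (B \<odot> B) Y) \<cdot>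
      ((\<iota> A \<otimes> \<alpha> B B Y) \<cdot> (\<iota> A \<otimes> \<delta> d' Y)))"
    by (simp add: assoc_nat[where A=A and B=B and D=Y, symmetric] coact_def[of d'] tensor_interchange
        cmp_reassoc)
  also have "\<dots> = (((\<iota> A \<otimes> \<tau> A B B) \<otimes> \<iota> Y) \<cdot> \<alpha> A (A \<odot> (B \<odot> B)) Y) \<cdot>
      ((\<iota> A \<otimes> \<alpha> A (B \<odot> B) Y) \<cdot> ((\<delta> d (B \<odot> B \<odot> Y) \<cdot> (\<iota> A \<otimes> \<alpha> B B Y)) \<cdot> (\<iota> A \<otimes> \<delta> d' Y)))"
    by (simp add: coact_tensor cmp_reassoc)
  also have "\<dots> = (\<alpha> A (B \<odot> (A \<odot> B)) Y \<cdot> (\<iota> A \<otimes> (\<tau> A B B \<otimes> \<iota> Y))) \<cdot>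
      ((\<iota> A \<otimes> \<alpha> A (B \<odot> B) Y) \<cdot> (((\<iota> A \<otimes> (\<iota> A \<otimes> \<alpha> B B Y)) \<cdot> \<delta> d (B \<odot> (B \<odot> Y))) \<cdot> (\<iota> A \<otimes> \<delta> d' Y)))"
    by (simp add: coact_nat assoc_nat[where A=A and B="A \<odot> (B \<odot> B)" and D=Y])
  also have "\<dots> = \<alpha> A (B \<odot> (A \<odot> B)) Y \<cdot> ((\<iota> A \<otimes> ((\<tau> A B B \<otimes> \<iota> Y) \<cdot> (\<alpha> A (B \<odot> B) Y \<cdot> (\<iota> A \<otimes> \<alpha> B B Y)))) \<cdot>
      (\<delta> d (B \<odot> (B \<odot> Y)) \<cdot> (\<iota> A \<otimes> \<delta> d' Y)))"
    by (simp add: tensor_ident_cmp cmp_reassoc)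
  also have "\<dots> = \<alpha> A (B \<odot> (A \<odot> B)) Y \<cdot> ((\<iota> A \<otimes> \<alpha> B (A \<odot> B) Y) \<cdot> ((\<iota> A \<otimes> (\<iota> B \<otimes> \<alpha> A B Y)) \<cdot> pair_coact Y))"
    by (simp add: transp_tensor) (simp add: pair_coact_def tensor_ident_cmp cmp_reassoc)
  finally show ?thesis .
qed

text \<open>
  The transposition \<open>\<tau> A B\<close> is a distributive law between the comonads \<open>A \<odot> _\<close>
  and \<open>B \<odot> _\<close>; this is coassociativity of the composite comonad.
\<close>

lemma pair_coact_pair_dup:
  "pair_coact (A \<odot> B) \<cdot> pair_dup = (\<iota> A \<otimes> (\<iota> B \<otimes> pair_dup)) \<cdot> pair_dup"
proof -
  let ?W = "B \<odot> (B \<odot> B)"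
  let ?T = "\<iota> A \<otimes> (\<iota> B \<otimes> (\<iota> A \<otimes> \<tau> A B B))"
  have "pair_coact (A \<odot> B) \<cdot> pair_dup
    = (\<iota> A \<otimes> \<tau> A B (B \<odot> (A \<odot> B))) \<cdot> (\<delta> d (B \<odot> (B \<odot> (A \<odot> B))) \<cdot> ((\<iota> A \<otimes> (\<delta> d' (A \<odot> B) \<cdot> \<tau> A B B)) \<cdot>
        (\<delta> d (B \<odot> B) \<cdot> (\<iota> A \<otimes> d'))))"
    by (simp add: pair_coact_def pair_dup_def cmp_reassoc tensor_ident_cmp)
  also have "\<dots> = (\<iota> A \<otimes> \<tau> A B (B \<odot> (A \<odot> B))) \<cdot> (\<delta> d (B \<odot> (B \<odot> (A \<odot> B))) \<cdot>
        ((\<iota> A \<otimes> (\<iota> B \<otimes> \<tau> A B B)) \<cdot> ((\<iota> A \<otimes> \<tau> A B (B \<odot> B)) \<cdot> (((\<iota> A \<otimes> (\<iota> A \<otimes> \<delta> d' B)) \<cdot> \<delta> d (B \<odot> B)) \<cdot> (\<iota> A \<otimes> d')))))"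
    by (simp add: coact_transp tensor_ident_cmp cmp_reassoc)
  also have "\<dots> = (\<iota> A \<otimes> \<tau> A B (B \<odot> (A \<odot> B))) \<cdot> ((\<delta> d (B \<odot> (B \<odot> (A \<odot> B))) \<cdot>
        (\<iota> A \<otimes> ((\<iota> B \<otimes> \<tau> A B B) \<cdot> \<tau> A B (B \<odot> B)))) \<cdot> (\<delta> d ?W \<cdot> (\<iota> A \<otimes> (\<delta> d' B \<cdot> d'))))"
    by (simp add: tensor_ident_cmp cmp_reassoc cmp_subst_left[OF coact_nat[of d A "\<delta> d' B" ?W]])
  \<comment> \<open>Naturality brings the two coactions of \<open>d\<close> next to each other, as
    was already done for \<open>d'\<close>, so that the coassociativity of each comonoid becomes
    applicable.\<close>
  also have "\<dots> = (\<iota> A \<otimes> (\<tau> A B (B \<odot> (A \<odot> B)) \<cdot> (\<iota> A \<otimes> (\<iota> B \<otimes> \<tau> A B B)))) \<cdot> ((\<iota> A \<otimes> (\<iota> A \<otimes> \<tau> A B (B \<odot> B))) \<cdot>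
        ((\<delta> d (A \<odot> ?W) \<cdot> \<delta> d ?W) \<cdot> (\<iota> A \<otimes> (\<delta> d' B \<cdot> d'))))"
    by (subst coact_nat) (simp_all add: tensor_ident_cmp cmp_reassoc)
  also have "\<dots> = ?T \<cdot> ((\<iota> A \<otimes> (\<tau> A B (A \<odot> (B \<odot> B)) \<cdot> ((\<iota> A \<otimes> \<tau> A B (B \<odot> B)) \<cdot> \<delta> d ?W))) \<cdot>
        (\<delta> d ?W \<cdot> (\<iota> A \<otimes> (\<delta> d' B \<cdot> d'))))"
    by (simp add: transp_nat coact_coact[OF comonoid_left]) (simp add: tensor_ident_cmp cmp_reassoc)
  also have "\<dots> = ?T \<cdot> ((\<iota> A \<otimes> (\<iota> B \<otimes> \<delta> d (B \<odot> B))) \<cdot> ((\<iota> A \<otimes> \<tau> A B (B \<odot> B)) \<cdot>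
        ((\<delta> d ?W \<cdot> (\<iota> A \<otimes> (\<iota> B \<otimes> d'))) \<cdot> (\<iota> A \<otimes> d'))))"
    by (simp add: transp_coact[symmetric] right_laws) (simp add: tensor_ident_cmp cmp_reassoc)
  also have "\<dots> = ?T \<cdot> ((\<iota> A \<otimes> (\<iota> B \<otimes> \<delta> d (B \<odot> B))) \<cdot> ((\<iota> A \<otimes> (\<tau> A B (B \<odot> B) \<cdot> (\<iota> A \<otimes> (\<iota> B \<otimes> d')))) \<cdot>
        (\<delta> d (B \<odot> B) \<cdot> (\<iota> A \<otimes> d'))))"
    by (simp add: coact_nat[of d A "\<iota> B \<otimes> d'"]) (simp add: tensor_ident_cmp cmp_reassoc)
  also have "\<dots> = (\<iota> A \<otimes> (\<iota> B \<otimes> pair_dup)) \<cdot> pair_dup"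
    by (simp add: transp_nat) (simp add: pair_dup_def tensor_ident_cmp cmp_reassoc)
  finally show ?thesis .
qed

text \<open>The pentagon collects the associators, and what is left is the coassociativity
  \<open>pair_coact_pair_dup\<close> of the composite comonad.\<close>

lemma tensor_dup_coassoc:
  "(tensor_dup \<otimes> \<iota> (A \<odot> B)) \<cdot> tensor_dup
    = \<alpha> (A \<odot> B) (A \<odot> B) (A \<odot> B) \<cdot> ((\<iota> (A \<odot> B) \<otimes> tensor_dup) \<cdot> tensor_dup)"
proof -
  let ?M = "A \<odot> B"
  have "(tensor_dup \<otimes> \<iota> ?M) \<cdot> tensor_dup
    = (\<alpha> A B ?M \<otimes> \<iota> ?M) \<cdot> (((pair_dup \<otimes> \<iota> ?M) \<cdot> \<alpha> A B ?M) \<cdot> pair_dup)"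
    by (simp add: tensor_dup_def tensor_ident_cmp cmp_reassoc)
  also have "\<dots> = ((\<alpha> A B ?M \<otimes> \<iota> ?M) \<cdot> (\<alpha> A (B \<odot> ?M) ?M \<cdot> (\<iota> A \<otimes> \<alpha> B ?M ?M))) \<cdot>
      ((\<iota> A \<otimes> (\<iota> B \<otimes> \<alpha> A B ?M)) \<cdot> (pair_coact ?M \<cdot> pair_dup))"
    by (simp add: pair_dup_tensor cmp_reassoc)
  also have "\<dots> = \<alpha> ?M ?M ?M \<cdot> ((\<alpha> A B (?M \<odot> ?M) \<cdot> (\<iota> A \<otimes> (\<iota> B \<otimes> tensor_dup))) \<cdot> pair_dup)"
    by (simp add: pentagon' pair_coact_pair_dup) (simp add: tensor_dup_def tensor_ident_cmp cmp_reassoc)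
  also have "\<dots> = \<alpha> ?M ?M ?M \<cdot> ((\<iota> ?M \<otimes> tensor_dup) \<cdot> tensor_dup)"
    by (simp add: assoc_nat_right) (simp add: tensor_dup_def cmp_reassoc)
  finally show ?thesis .
qed

lemma tensor_dup_counit: "\<theta> tensor_discard (A \<odot> B) \<cdot> tensor_dup = \<iota> (A \<odot> B)"
proof -
  let ?M = "A \<odot> B"
  have "\<theta> tensor_discard ?M \<cdot> tensor_dup = (\<theta> (e' \<cdot> \<theta> e B) ?M \<cdot> \<alpha> A B ?M) \<cdot> pair_dup"
    by (simp add: tensor_dup_def tensor_discard_def cmp_reassoc)
  also have "\<dots> = \<theta> e' ?M \<cdot> ((\<theta> e (B \<odot> ?M) \<cdot> (\<iota> A \<otimes> \<tau> A B B)) \<cdot> (\<delta> d (B \<odot> B) \<cdot> (\<iota> A \<otimes> d')))"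
    by (simp add: discard_discard pair_dup_def cmp_reassoc)
  also have "\<dots> = (\<theta> e' ?M \<cdot> \<tau> A B B) \<cdot> ((\<theta> e (A \<odot> (B \<odot> B)) \<cdot> \<delta> d (B \<odot> B)) \<cdot> (\<iota> A \<otimes> d'))"
    by (simp add: discard_nat cmp_reassoc)
  also have "\<dots> = \<iota> A \<otimes> (\<theta> e' B \<cdot> d')"
    by (simp add: discard_transp discard_coact[OF comonoid_left] tensor_interchange)
  finally show ?thesis
    by (simp add: right_laws)
qed

text \<open>The symmetry of A \<odot> B with itself consists of four crossings. One cancels the
  transposition in \<open>pair_dup\<close>, the crossings of \<open>A\<close> with \<open>A\<close>
  and of \<open>B\<close> with \<open>B\<close> are absorbed by cocommutativity of \<open>d\<close>
  and \<open>d'\<close>, and the last one restores the transposition.\<close>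

lemma tensor_dup_cocommutative: "\<sigma> (A \<odot> B) (A \<odot> B) \<cdot> tensor_dup = tensor_dup"
proof -
  let ?M = "A \<odot> B"
  have d: "\<delta> d (B \<odot> B) \<cdot> (\<iota> A \<otimes> d') = \<beta> A A (B \<odot> B) \<cdot> (d \<otimes> d')"
    by (simp add: coact_def cmp_reassoc tensor_interchange)
  have "\<sigma> ?M ?M \<cdot> tensor_dup = (\<sigma> ?M ?M \<cdot> \<alpha> A B ?M) \<cdot> pair_dup"
    by (simp add: tensor_dup_def cmp_reassoc)
  also have "\<dots> = (\<tau> A ?M B \<cdot> (\<iota> A \<otimes> \<alpha> A B B)) \<cdot> ((\<iota> A \<otimes> (\<iota> A \<otimes> \<sigma> B B)) \<cdot> ((\<iota> A \<otimes> \<tau> B A B) \<cdot> pair_dup))"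
    by (simp add: swap_tensor_left) (simp add: swap_tensor_right[of A B B] tensor_ident_cmp cmp_reassoc)
  also have "\<dots> = \<alpha> A B ?M \<cdot> ((\<iota> A \<otimes> \<tau> A B B) \<cdot> ((\<tau> A A (B \<odot> B) \<cdot> (\<iota> A \<otimes> (\<iota> A \<otimes> \<sigma> B B))) \<cdot>
      (\<beta> A A (B \<odot> B) \<cdot> (d \<otimes> d'))))"
    by (simp add: transp_tensor_right pair_dup_def d cmp_reassoc cmp_subst_left[OF tensor_transp_transp])
  also have "\<dots> = \<alpha> A B ?M \<cdot> ((\<iota> A \<otimes> \<tau> A B B) \<cdot> (\<tau> A A (B \<odot> B) \<cdot>
      ((\<beta> A A (B \<odot> B) \<cdot> (\<iota> (A \<odot> A) \<otimes> \<sigma> B B)) \<cdot> (d \<otimes> d'))))"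
    by (simp add: assoc_inv_nat_right cmp_reassoc)
  also have "\<dots> = \<alpha> A B ?M \<cdot> ((\<iota> A \<otimes> \<tau> A B B) \<cdot> (\<beta> A A (B \<odot> B) \<cdot> (d \<otimes> d')))"
    by (simp add: transp_def[of A A] cmp_reassoc tensor_interchange left_laws right_laws)
  also have "\<dots> = tensor_dup"
    by (simp add: tensor_dup_def pair_dup_def d)
  finally show ?thesis .
qed

theorem tensor_comonoid: "cocommutative_comonoid C (A \<odot> B) tensor_dup tensor_discard"
proof -
  let ?M = "A \<odot> B"
  have l: "\<ell> ?M \<cdot> ((tensor_discard \<otimes> \<iota> ?M) \<cdot> tensor_dup) = \<iota> ?M"
    using tensor_dup_counit by (simp add: discard_def cmp_reassoc)
  \<comment> \<open>The right counit law follows from the left one by cocommutativity.\<close>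
  have "\<rho> ?M \<cdot> ((\<iota> ?M \<otimes> tensor_discard) \<cdot> tensor_dup)
    = \<ell> ?M \<cdot> ((\<sigma> ?M \<I> \<cdot> (\<iota> ?M \<otimes> tensor_discard)) \<cdot> tensor_dup)"
    by (simp add: swap_unit[symmetric] cmp_reassoc)
  also have "\<dots> = \<ell> ?M \<cdot> ((tensor_discard \<otimes> \<iota> ?M) \<cdot> (\<sigma> ?M ?M \<cdot> tensor_dup))"
    by (simp add: swap_nat[where A="?M" and D="?M"] cmp_reassoc)
  also have "\<dots> = \<iota> ?M"
    by (simp add: tensor_dup_cocommutative l)
  finally show ?thesis
    using tensor_dup_coassoc tensor_dup_cocommutative l
    by (simp add: cocommutative_comonoid_def hom_iff cmp_reassoc)
qed

text \<open>Surjective pairing for the tensor comonoid: the two factors are the projections. Each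
  surplus copy is removed by the counit law of its own comonoid.\<close>

lemma proj_tensor_dup:
  "((\<rho> A \<cdot> (\<iota> A \<otimes> e')) \<otimes> \<theta> e B) \<cdot> tensor_dup = \<iota> (A \<odot> B)"
proof -
  let ?M = "A \<odot> B"
  have "((\<rho> A \<cdot> (\<iota> A \<otimes> e')) \<otimes> \<theta> e B) \<cdot> tensor_dup
    = (\<iota> A \<otimes> \<theta> e B) \<cdot> ((\<rho> A \<otimes> \<iota> ?M) \<cdot> ((((\<iota> A \<otimes> e') \<otimes> \<iota> ?M) \<cdot> \<alpha> A B ?M) \<cdot> pair_dup))"
    by (simp add: tensor_dup_def cmp_reassoc tensor_interchange_tail)
  also have "\<dots> = (\<iota> A \<otimes> \<theta> e B) \<cdot> (((\<rho> A \<otimes> \<iota> ?M) \<cdot> \<alpha> A \<I> ?M) \<cdot> ((\<iota> A \<otimes> (e' \<otimes> \<iota> ?M)) \<cdot> pair_dup))"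
    by (simp add: assoc_nat[where A=A and B=B and D="?M", symmetric] cmp_reassoc)
  also have "\<dots> = (\<iota> A \<otimes> \<theta> e B) \<cdot> ((\<iota> A \<otimes> (\<theta> e' ?M \<cdot> \<tau> A B B)) \<cdot> (\<delta> d (B \<odot> B) \<cdot> (\<iota> A \<otimes> d')))"
    by (simp add: triangle discard_def pair_dup_def tensor_ident_cmp cmp_reassoc)
  also have "\<dots> = (\<iota> A \<otimes> \<theta> e B) \<cdot> (((\<iota> A \<otimes> (\<iota> A \<otimes> \<theta> e' B)) \<cdot> \<delta> d (B \<odot> B)) \<cdot> (\<iota> A \<otimes> d'))"
    by (simp add: discard_transp cmp_reassoc)
  also have "\<dots> = ((\<iota> A \<otimes> \<theta> e B) \<cdot> \<delta> d B) \<cdot> (\<iota> A \<otimes> (\<theta> e' B \<cdot> d'))"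
    by (simp add: tensor_ident_cmp cmp_reassoc cmp_subst_left[OF coact_nat[of d A "\<theta> e' B" B]])
  also have "\<dots> = \<iota> ?M"
    by (simp add: tensor_discard_coact[OF comonoid_left] right_laws)
  finally show ?thesis .
qed

end

section \<open>Restriction products and the order\<close>

context partial_cartesian_category
begin

section \<open>Projections and pairings of partial maps\<close>

lemma diag_bang_typ [simp]:
  assumes "A \<in> Ob C"
  shows "\<Delta> A \<in> Ar C" "src C (\<Delta> A) = A" "trg C (\<Delta> A) = A \<odot> A"
    "\<epsilon> A \<in> Ar C" "src C (\<epsilon> A) = A" "trg C (\<epsilon> A) = \<I>"
    "\<nabla> A \<in> Ar C" "src C (\<nabla> A) = A \<odot> A" "trg C (\<nabla> A) = A"
  using comonoid_typ[OF comonoid[OF assms]] codiag_hom[OF assms] by (auto simp: hom_iff)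

lemma diag_nat: "\<lbrakk>f \<in> Ar C; trg C f = B\<rbrakk> \<Longrightarrow> \<Delta> B \<cdot> f = (f \<otimes> f) \<cdot> \<Delta> (src C f)"
  using diag_natural[of f "src C f" B] by (simp add: hom_iff)

definition proj1 ("\<pi>\<^sub>1") where "\<pi>\<^sub>1 A B = \<rho> A \<cdot> (\<iota> A \<otimes> \<epsilon> B)"
definition proj2 ("\<pi>\<^sub>2") where "\<pi>\<^sub>2 A B = \<theta> (\<epsilon> A) B"
definition pairing ("\<langle>_, _\<rangle>") where "\<langle>f, g\<rangle> = (f \<otimes> g) \<cdot> \<Delta> (src C f)"

lemma proj_typ [simp]:
  assumes "A \<in> Ob C" "B \<in> Ob C"
  shows "\<pi>\<^sub>1 A B \<in> Ar C" "src C (\<pi>\<^sub>1 A B) = A \<odot> B" "trg C (\<pi>\<^sub>1 A B) = A"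
    "\<pi>\<^sub>2 A B \<in> Ar C" "src C (\<pi>\<^sub>2 A B) = A \<odot> B" "trg C (\<pi>\<^sub>2 A B) = B"
  using assms by (simp_all add: proj1_def proj2_def)

lemma pairing_typ [simp]:
  assumes "f \<in> Ar C" "g \<in> Ar C" "src C f = src C g"
  shows "\<langle>f, g\<rangle> \<in> Ar C" "src C \<langle>f, g\<rangle> = src C g" "trg C \<langle>f, g\<rangle> = trg C f \<odot> trg C g"
  using assms by (simp_all add: pairing_def)

lemma restr_typ [simp]:
  assumes "f \<in> Ar C"
  shows "restr C f \<in> Ar C" "src C (restr C f) = src C f" "trg C (restr C f) = src C f"
  using assms by (simp_all add: restr_def)

lemma restr_cong:
  "\<lbrakk>\<epsilon> (trg C f) \<cdot> f = \<epsilon> (trg C g) \<cdot> g; src C f = src C g\<rbrakk> \<Longrightarrow> restr C f = restr C g"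
  by (simp add: restr_def)

lemma restr_ident [simp]: "A \<in> Ob C \<Longrightarrow> restr C (\<iota> A) = \<iota> A"
  using comonoid_laws(3)[OF comonoid[of A]] by (simp add: restr_def cmp_reassoc)

lemma pairing_cmp:
  assumes [simp]: "f \<in> Ar C" "g \<in> Ar C" "h \<in> Ar C" "src C f = src C g" "trg C h = src C g"
  shows "\<langle>f, g\<rangle> \<cdot> h = \<langle>f \<cdot> h, g \<cdot> h\<rangle>"
proof -
  have "\<langle>f, g\<rangle> \<cdot> h = (f \<otimes> g) \<cdot> (\<Delta> (src C g) \<cdot> h)"
    by (simp add: pairing_def cmp_reassoc)
  also have "\<dots> = (f \<otimes> g) \<cdot> ((h \<otimes> h) \<cdot> \<Delta> (src C h))"
    by (simp add: diag_nat)
  also have "\<dots> = \<langle>f \<cdot> h, g \<cdot> h\<rangle>"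
    by (simp add: pairing_def tensor_interchange_tail)
  finally show ?thesis .
qed

lemma tensor_pairing:
  assumes [simp]: "f \<in> Ar C" "g \<in> Ar C" "h \<in> Ar C" "k \<in> Ar C"
    "src C h = src C k" "trg C h = src C f" "trg C k = src C g"
  shows "(f \<otimes> g) \<cdot> \<langle>h, k\<rangle> = \<langle>f \<cdot> h, g \<cdot> k\<rangle>"
  by (simp add: pairing_def tensor_interchange_tail)

lemma pairing_same: "f \<in> Ar C \<Longrightarrow> \<langle>f, f\<rangle> = \<Delta> (trg C f) \<cdot> f"
  by (simp add: pairing_def diag_nat)

text \<open>A pairing is defined only where both components are, hence the restriction to the domain
  of \<open>g\<close>.\<close>

lemma proj1_pairing:
  assumes [simp]: "f \<in> Ar C" "g \<in> Ar C" "src C f = src C g" "trg C f = A" "trg C g = B"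
  shows "\<pi>\<^sub>1 A B \<cdot> \<langle>f, g\<rangle> = f \<cdot> restr C g"
proof -
  have [simp]: "A \<in> Ob C" "B \<in> Ob C"
    using src_trg_Ob(2)[OF assms(1)] src_trg_Ob(2)[OF assms(2)] by simp_all
  have "\<pi>\<^sub>1 A B \<cdot> \<langle>f, g\<rangle> = (\<rho> A \<cdot> (f \<otimes> \<iota> \<I>)) \<cdot> ((\<iota> (src C g) \<otimes> (\<epsilon> B \<cdot> g)) \<cdot> \<Delta> (src C g))"
    by (simp add: proj1_def pairing_def cmp_reassoc tensor_interchange_tail)
  also have "\<dots> = f \<cdot> restr C g"
    by (simp add: runit_nat[of f, OF _ refl] restr_def cmp_reassoc)
  finally show ?thesis .
qed

text \<open>\<open>restr\<close> discards the right copy, but the second projection discards the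
  left one; cocommutativity and \<open>swap_unit\<close> mediate between the two.\<close>

lemma proj2_pairing:
  assumes [simp]: "f \<in> Ar C" "g \<in> Ar C" "src C f = src C g" "trg C f = A" "trg C g = B"
  shows "\<pi>\<^sub>2 A B \<cdot> \<langle>f, g\<rangle> = g \<cdot> restr C f"
proof -
  let ?S = "src C g"
  have [simp]: "A \<in> Ob C" "B \<in> Ob C"
    using src_trg_Ob(2)[OF assms(1)] src_trg_Ob(2)[OF assms(2)] by simp_all
  have "\<pi>\<^sub>2 A B \<cdot> \<langle>f, g\<rangle> = (\<ell> B \<cdot> (\<iota> \<I> \<otimes> g)) \<cdot> (((\<epsilon> A \<cdot> f) \<otimes> \<iota> ?S) \<cdot> \<Delta> ?S)"
    by (simp add: proj2_def discard_def pairing_def cmp_reassoc tensor_interchange_tail)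
  also have "\<dots> = g \<cdot> (\<ell> ?S \<cdot> (((\<epsilon> A \<cdot> f) \<otimes> \<iota> ?S) \<cdot> (\<sigma> ?S ?S \<cdot> \<Delta> ?S)))"
    by (simp add: lunit_nat[of g, OF _ refl] comonoid_laws(4)[OF comonoid] cmp_reassoc)
  also have "\<dots> = g \<cdot> ((\<ell> ?S \<cdot> \<sigma> ?S \<I>) \<cdot> ((\<iota> ?S \<otimes> (\<epsilon> A \<cdot> f)) \<cdot> \<Delta> ?S))"
    by (simp add: cmp_reassoc cmp_subst_left[OF swap_nat[of "\<iota> ?S" "\<epsilon> A \<cdot> f" ?S ?S ?S \<I>]])
  also have "\<dots> = g \<cdot> restr C f"
    by (simp add: swap_unit restr_def cmp_reassoc)
  finally show ?thesis .
qed

lemma proj2_diag: "A \<in> Ob C \<Longrightarrow> \<pi>\<^sub>2 A A \<cdot> \<Delta> A = \<iota> A"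
  using comonoid_laws(2)[OF comonoid[of A]] by (simp add: proj2_def)

text \<open>
  This is where uniqueness of comonoid structures enters: it identifies \<open>\<Delta> (A \<odot> B)\<close> and
  \<open>\<epsilon> (A \<odot> B)\<close> with the tensor of the comonoids on \<open>A\<close> and \<open>B\<close>.
\<close>

lemma
  assumes [simp]: "A \<in> Ob C" "B \<in> Ob C"
  shows pairing_proj_ident: "\<langle>\<pi>\<^sub>1 A B, \<pi>\<^sub>2 A B\<rangle> = \<iota> (A \<odot> B)"
    and bang_tensor_proj2: "\<epsilon> (A \<odot> B) = \<epsilon> B \<cdot> \<pi>\<^sub>2 A B"
    and bang_tensor_proj1: "\<epsilon> (A \<odot> B) = \<epsilon> A \<cdot> \<pi>\<^sub>1 A B"
proof -
  interpret comonoid_pair C A "\<Delta> A" "\<epsilon> A" B "\<Delta> B" "\<epsilon> B"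
    by unfold_locales (simp_all add: comonoid)
  have eq: "tensor_dup = \<Delta> (A \<odot> B)" "tensor_discard = \<epsilon> (A \<odot> B)"
    using comonoid_unique[OF _ tensor_comonoid] by simp_all
  show "\<langle>\<pi>\<^sub>1 A B, \<pi>\<^sub>2 A B\<rangle> = \<iota> (A \<odot> B)"
    using proj_tensor_dup by (simp add: pairing_def eq proj1_def proj2_def)
  show 2: "\<epsilon> (A \<odot> B) = \<epsilon> B \<cdot> \<pi>\<^sub>2 A B"
    by (simp add: eq(2)[symmetric] tensor_discard_def proj2_def)
  \<comment> \<open>Discarding a pair from the left or from the right gives the same map because
    \<ell> and \<rho> coincide at \<I>.\<close>
  have "\<epsilon> B \<cdot> \<pi>\<^sub>2 A B = (\<epsilon> B \<cdot> \<ell> B) \<cdot> (\<epsilon> A \<otimes> \<iota> B)"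
    by (simp add: proj2_def discard_def cmp_reassoc)
  also have "\<dots> = \<ell> \<I> \<cdot> (\<epsilon> A \<otimes> \<epsilon> B)"
    by (simp add: lunit_nat[of "\<epsilon> B" B \<I>, symmetric] cmp_reassoc tensor_interchange)
  also have "\<dots> = (\<rho> \<I> \<cdot> (\<epsilon> A \<otimes> \<iota> \<I>)) \<cdot> (\<iota> A \<otimes> \<epsilon> B)"
    by (simp add: unit_coherence cmp_reassoc tensor_interchange)
  also have "\<dots> = \<epsilon> A \<cdot> \<pi>\<^sub>1 A B"
    by (simp add: runit_nat[of "\<epsilon> A" A \<I>] proj1_def cmp_reassoc)
  finally show "\<epsilon> (A \<odot> B) = \<epsilon> A \<cdot> \<pi>\<^sub>1 A B" using 2 by simp
qed

lemma pairing_proj: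
  assumes [simp]: "A \<in> Ob C" "B \<in> Ob C" "k \<in> Ar C" "trg C k = A \<odot> B"
  shows "\<langle>\<pi>\<^sub>1 A B \<cdot> k, \<pi>\<^sub>2 A B \<cdot> k\<rangle> = k"
  by (simp add: pairing_cmp[symmetric] pairing_proj_ident)

lemma pairing_assoc:
  assumes [simp]: "f \<in> Ar C" "g \<in> Ar C" "h \<in> Ar C" "src C f = S" "src C g = S" "src C h = S"
  shows "\<alpha> (trg C f) (trg C g) (trg C h) \<cdot> \<langle>f, \<langle>g, h\<rangle>\<rangle> = \<langle>\<langle>f, g\<rangle>, h\<rangle>"
proof -
  have [simp]: "S \<in> Ob C" using src_trg_Ob(1)[OF assms(1)] by simp
  have "\<langle>f, \<langle>g, h\<rangle>\<rangle> = (f \<otimes> (g \<otimes> h)) \<cdot> ((\<iota> S \<otimes> \<Delta> S) \<cdot> \<Delta> S)"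
    by (simp add: pairing_def tensor_interchange_tail)
  also have "\<dots> = (f \<otimes> (g \<otimes> h)) \<cdot> (\<beta> S S S \<cdot> ((\<Delta> S \<otimes> \<iota> S) \<cdot> \<Delta> S))"
    using comonoid_laws(1)[OF comonoid[of S]] by (simp add: coact_def cmp_reassoc)
  finally have "\<alpha> (trg C f) (trg C g) (trg C h) \<cdot> \<langle>f, \<langle>g, h\<rangle>\<rangle>
    = (\<alpha> (trg C f) (trg C g) (trg C h) \<cdot> (f \<otimes> (g \<otimes> h))) \<cdot> (\<beta> S S S \<cdot> ((\<Delta> S \<otimes> \<iota> S) \<cdot> \<Delta> S))"
    by (simp add: cmp_reassoc)
  also have "\<dots> = ((f \<otimes> g) \<otimes> h) \<cdot> ((\<Delta> S \<otimes> \<iota> S) \<cdot> \<Delta> S)"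
    by (simp add: assoc_nat[of f g h S S S] cmp_reassoc)
  also have "\<dots> = \<langle>\<langle>f, g\<rangle>, h\<rangle>"
    by (simp add: pairing_def tensor_interchange_tail)
  finally show ?thesis .
qed

section \<open>The laws of a restriction category\<close>

lemma cmp_restr_self [simp]:
  assumes [simp]: "f \<in> Ar C"
  shows "f \<cdot> restr C f = f"
  using proj2_pairing[of f f] by (simp add: pairing_same cmp_subst_left[OF proj2_diag])

text \<open>The restriction of \<open>g\<close> is the first projection of \<langle>\<iota>,
  g\<rangle>, and pairings commute with precomposition.\<close>

lemma restr_cmp:
  assumes [simp]: "f \<in> Ar C" "g \<in> Ar C" "trg C f = src C g"
  shows "restr C g \<cdot> f = f \<cdot> restr C (g \<cdot> f)"
proof -
  have "restr C g \<cdot> f = (\<pi>\<^sub>1 (src C g) (trg C g) \<cdot> \<langle>\<iota> (src C g), g\<rangle>) \<cdot> f"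
    by (simp add: proj1_pairing)
  also have "\<dots> = \<pi>\<^sub>1 (src C g) (trg C g) \<cdot> \<langle>f, g \<cdot> f\<rangle>"
    by (simp add: cmp_reassoc pairing_cmp)
  finally show ?thesis
    by (simp add: proj1_pairing)
qed

text \<open>The restriction is the second projection of \<langle>\<langle>f, g\<rangle>,
  \<iota>\<rangle>. Since the counit of a tensor discards its factors one after the other,
  reassociating leaves two successive projections.\<close>

lemma restr_pairing:
  assumes [simp]: "f \<in> Ar C" "g \<in> Ar C" "src C f = S" "src C g = S"
  shows "restr C \<langle>f, g\<rangle> = restr C g \<cdot> restr C f"
proof -
  have [simp]: "S \<in> Ob C" using src_trg_Ob(1)[OF assms(1)] by simp
  have "restr C \<langle>f, g\<rangle> = \<pi>\<^sub>2 (trg C f \<odot> trg C g) S \<cdot> \<langle>\<langle>f, g\<rangle>, \<iota> S\<rangle>"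
    by (simp add: proj2_pairing)
  also have "\<dots> = (\<theta> (\<epsilon> (trg C g) \<cdot> \<theta> (\<epsilon> (trg C f)) (trg C g)) S \<cdot> \<alpha> (trg C f) (trg C g) S) \<cdot> \<langle>f, \<langle>g, \<iota> S\<rangle>\<rangle>"
    using pairing_assoc[of f g "\<iota> S" S] by (simp add: proj2_def bang_tensor_proj2 cmp_reassoc)
  also have "\<dots> = \<pi>\<^sub>2 (trg C g) S \<cdot> (\<pi>\<^sub>2 (trg C f) (trg C g \<odot> S) \<cdot> \<langle>f, \<langle>g, \<iota> S\<rangle>\<rangle>)"
    by (simp add: discard_discard proj2_def cmp_reassoc)
  also have "\<dots> = restr C g \<cdot> restr C f"
    by (simp add: proj2_pairing cmp_subst_left[OF proj2_pairing])
  finally show ?thesis .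
qed

text \<open>\<open>g \<cdot> restr C f\<close> is a projection of \<langle>f, g\<rangle>, and
  projecting does not change the domain because the counit of a tensor factors through each
  projection.\<close>

lemma restr_cmp_restr:
  assumes [simp]: "f \<in> Ar C" "g \<in> Ar C" "src C f = src C g"
  shows "restr C (g \<cdot> restr C f) = restr C g \<cdot> restr C f"
proof -
  have "restr C (g \<cdot> restr C f) = restr C (\<pi>\<^sub>2 (trg C f) (trg C g) \<cdot> \<langle>f, g\<rangle>)"
    by (simp add: proj2_pairing)
  also have "\<dots> = restr C \<langle>f, g\<rangle>"
    by (rule restr_cong) (simp_all add: bang_tensor_proj2 cmp_reassoc)
  finally show ?thesis by (simp add: restr_pairing)
qed

text \<open>Both orders of composition compute the domain of \<langle>f, g\<rangle>, one through
  each projection.\<close>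

lemma restr_commute:
  assumes [simp]: "f \<in> Ar C" "g \<in> Ar C" "src C f = src C g"
  shows "restr C f \<cdot> restr C g = restr C g \<cdot> restr C f"
proof -
  have "restr C (f \<cdot> restr C g) = restr C (\<pi>\<^sub>1 (trg C f) (trg C g) \<cdot> \<langle>f, g\<rangle>)"
    by (simp add: proj1_pairing)
  also have "\<dots> = restr C \<langle>f, g\<rangle>"
    by (rule restr_cong) (simp_all add: bang_tensor_proj1 cmp_reassoc)
  finally show ?thesis by (simp add: restr_pairing restr_cmp_restr)
qed

lemma restr_restr [simp]: "f \<in> Ar C \<Longrightarrow> restr C (restr C f) = restr C f"
  using restr_cmp_restr[of f "\<iota> (src C f)"] by simp

lemma restr_idem [simp]: "f \<in> Ar C \<Longrightarrow> restr C f \<cdot> restr C f = restr C f"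
  using restr_cmp_restr[of f f] by simp

lemma restr_below_ident:
  assumes [simp]: "f \<in> Ar C" "src C f = A"
  shows "restr C f \<sqsubseteq> \<iota> A"
proof -
  have [simp]: "A \<in> Ob C" using src_trg_Ob(1)[OF assms(1)] by simp
  have "\<epsilon> (trg C f) \<cdot> f \<sqsubseteq> \<epsilon> A"
    by (rule bang_lax_natural) (simp add: hom_iff)
  then have "\<iota> A \<otimes> (\<epsilon> (trg C f) \<cdot> f) \<sqsubseteq> \<iota> A \<otimes> \<epsilon> A"
    by (intro tensor_mono[where A=A and B=A and D=A and E="\<I>"]) (simp_all add: hom_iff below_refl')
  then have "\<rho> A \<cdot> ((\<iota> A \<otimes> (\<epsilon> (trg C f) \<cdot> f)) \<cdot> \<Delta> A) \<sqsubseteq> \<rho> A \<cdot> ((\<iota> A \<otimes> \<epsilon> A) \<cdot> \<Delta> A)"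
    by (intro below_cmp_left below_cmp_right) simp_all
  then show ?thesis
    by (simp add: comonoid_laws(3)[OF comonoid] restr_def cmp_reassoc)
qed

section \<open>The codiagonal, meets and the order\<close>

lemma codiag_proj2:
  assumes [simp]: "A \<in> Ob C"
  shows "\<nabla> A = \<pi>\<^sub>2 A A \<cdot> restr C (\<nabla> A)"
proof -
  have "(\<iota> A \<otimes> \<Delta> A) = (\<iota> A \<otimes> \<Delta> A) \<cdot> \<langle>\<pi>\<^sub>1 A A, \<pi>\<^sub>2 A A\<rangle>"
    by (simp add: pairing_proj_ident)
  also have "\<dots> = \<langle>\<pi>\<^sub>1 A A, \<langle>\<pi>\<^sub>2 A A, \<pi>\<^sub>2 A A\<rangle>\<rangle>"
    by (simp add: tensor_pairing pairing_same)
  finally have *: "\<alpha> A A A \<cdot> (\<iota> A \<otimes> \<Delta> A) = \<langle>\<iota> (A \<odot> A), \<pi>\<^sub>2 A A\<rangle>"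
    using pairing_assoc[of "\<pi>\<^sub>1 A A" "\<pi>\<^sub>2 A A" "\<pi>\<^sub>2 A A" "A \<odot> A"] by (simp add: pairing_proj_ident)
  \<comment> \<open>The Frobenius law makes \<open>\<Delta> A \<cdot> \<nabla> A\<close> the pairing
    of \<open>\<nabla> A\<close> with the second projection. Hence the codiagonal is the second
    projection restricted to its domain.\<close>
  have "\<nabla> A = \<pi>\<^sub>2 A A \<cdot> (\<Delta> A \<cdot> \<nabla> A)"
    by (simp add: cmp_subst_left[OF proj2_diag])
  also have "\<dots> = \<pi>\<^sub>2 A A \<cdot> ((\<nabla> A \<otimes> \<iota> A) \<cdot> \<langle>\<iota> (A \<odot> A), \<pi>\<^sub>2 A A\<rangle>)"
    by (simp add: frobenius cmp_reassoc *)
  also have "\<dots> = \<pi>\<^sub>2 A A \<cdot> restr C (\<nabla> A)"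
    by (simp add: tensor_pairing proj2_pairing)
  finally show ?thesis .
qed

definition meet (infixl "\<sqinter>" 65) where "f \<sqinter> g = \<nabla> (trg C f) \<cdot> \<langle>f, g\<rangle>"

lemma meet_typ [simp]:
  assumes "f \<in> Ar C" "g \<in> Ar C" "src C f = src C g" "trg C f = trg C g"
  shows "f \<sqinter> g \<in> Ar C" "src C (f \<sqinter> g) = src C g" "trg C (f \<sqinter> g) = trg C g"
  using assms by (simp_all add: meet_def)

lemma meet_below_left:
  assumes [simp]: "f \<in> Ar C" "g \<in> Ar C" "src C f = src C g" "trg C f = trg C g"
  shows "f \<sqinter> g \<sqsubseteq> f"
  using convolution_below[of f "src C f" "trg C f" g] by (simp add: hom_iff meet_def pairing_def cmp_reassoc)

lemma meet_eq_cmp_restr: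
  assumes [simp]: "f \<in> Ar C" "g \<in> Ar C" "src C f = src C g" "trg C f = trg C g"
  shows "f \<sqinter> g = g \<cdot> (restr C f \<cdot> restr C (f \<sqinter> g))"
proof -
  let ?B = "trg C g"
  have "f \<sqinter> g = (\<pi>\<^sub>2 ?B ?B \<cdot> restr C (\<nabla> ?B)) \<cdot> \<langle>f, g\<rangle>"
    by (simp add: meet_def codiag_proj2[symmetric])
  also have "\<dots> = (\<pi>\<^sub>2 ?B ?B \<cdot> \<langle>f, g\<rangle>) \<cdot> restr C (f \<sqinter> g)"
    by (simp add: meet_def cmp_reassoc restr_cmp)
  finally show ?thesis by (simp add: proj2_pairing cmp_reassoc)
qed

text \<open>The adjunction gives one inequality; the other is \<open>convolution_below\<close> for
  two identities.\<close>

lemma codiag_diag: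
  assumes [simp]: "A \<in> Ob C"
  shows "\<nabla> A \<cdot> \<Delta> A = \<iota> A"
proof (rule below_antisym')
  show "\<nabla> A \<cdot> \<Delta> A \<sqsubseteq> \<iota> A"
    using meet_below_left[of "\<iota> A" "\<iota> A"] by (simp add: meet_def pairing_def)
qed (simp_all add: adjunction_unit)

lemma meet_same: "f \<in> Ar C \<Longrightarrow> f \<sqinter> f = f"
  by (simp add: meet_def pairing_same cmp_subst_left[OF codiag_diag])

lemma meet_cmp:
  assumes [simp]: "f \<in> Ar C" "g \<in> Ar C" "h \<in> Ar C" "src C f = src C g" "trg C f = trg C g" "trg C h = src C g"
  shows "(f \<sqinter> g) \<cdot> h = (f \<cdot> h) \<sqinter> (g \<cdot> h)"
  by (simp add: meet_def cmp_reassoc pairing_cmp)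

lemma below_imp_meet:
  assumes "f \<sqsubseteq> g" and [simp]: "f \<in> Ar C" "g \<in> Ar C" "src C f = src C g" "trg C f = trg C g"
  shows "f \<sqinter> g = f"
proof (rule below_antisym')
  have "f \<otimes> f \<sqsubseteq> f \<otimes> g"
    by (intro tensor_mono[of f "src C g" "trg C g" f f "src C g" "trg C g" g])
      (simp_all add: hom_iff below_refl' assms(1))
  then have "f \<sqinter> f \<sqsubseteq> f \<sqinter> g"
    unfolding meet_def pairing_def by (intro below_cmp_left below_cmp_right) simp_all
  then show "f \<sqsubseteq> f \<sqinter> g" by (simp add: meet_same)
qed (simp_all add: meet_below_left)

lemma cmp_restr_below:
  assumes [simp]: "f \<in> Ar C" "g \<in> Ar C" "src C f = src C g"
  shows "g \<cdot> restr C f \<sqsubseteq> g"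
  using below_cmp_left[OF restr_below_ident[of f "src C g"], of g] by simp

text \<open>If \<open>f \<sqsubseteq> g\<close>, then \<open>f\<close> is the meet of both, which
  \<open>meet_eq_cmp_restr\<close> exhibits as a restriction of \<open>g\<close>. The converse holds
  because restrictions lie below identities.\<close>

lemma below_iff_restr:
  assumes [simp]: "f \<in> Ar C" "g \<in> Ar C" "src C f = src C g" "trg C f = trg C g"
  shows "f \<sqsubseteq> g \<longleftrightarrow> f = g \<cdot> restr C f"
proof
  assume "f \<sqsubseteq> g"
  then have "f \<sqinter> g = f" by (rule below_imp_meet) simp_all
  then show "f = g \<cdot> restr C f"
    using meet_eq_cmp_restr[of f g] by simp
next
  assume "f = g \<cdot> restr C f"
  then show "f \<sqsubseteq> g" using cmp_restr_below[of f g] by simp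
qed

text \<open>The axiom \<open>convolution_below\<close> bounds the meet by its left argument only.
  That bound places the domain of the meet inside the domain of \<open>f\<close>, so
  \<open>meet_eq_cmp_restr\<close> reduces to a restriction of \<open>g\<close>.\<close>

lemma meet_below_right:
  assumes [simp]: "f \<in> Ar C" "g \<in> Ar C" "src C f = src C g" "trg C f = trg C g"
  shows "f \<sqinter> g \<sqsubseteq> g"
proof -
  have "restr C (f \<sqinter> g) = restr C f \<cdot> restr C (f \<sqinter> g)"
  proof -
    have *: "f \<sqinter> g = f \<cdot> restr C (f \<sqinter> g)"
      by (rule iffD1[OF below_iff_restr]) (simp_all add: meet_below_left)
    have "restr C (f \<cdot> restr C (f \<sqinter> g)) = restr C f \<cdot> restr C (f \<sqinter> g)"
      by (rule restr_cmp_restr) simp_all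
    then show ?thesis by (simp add: *[symmetric])
  qed
  then show ?thesis
    using meet_eq_cmp_restr[of f g] by (simp add: below_iff_restr)
qed

lemma restr_cmp_below:
  assumes [simp]: "f \<in> Ar C" "g \<in> Ar C" "trg C f = src C g"
  shows "restr C g \<cdot> f \<sqsubseteq> f"
  using below_cmp_right[OF restr_below_ident[of g "src C g"], of f] by simp

end

section \<open>Weak comma objects and Heyting operations\<close>

context partial_cartesian_category
begin

section \<open>From weak comma objects to Heyting operations\<close>

lemma weak_comma_unique_lift:
  assumes "weak_comma C f g P p q" "f \<cdot> \<phi> \<sqsubseteq> g \<cdot> \<psi>" "\<phi> \<in> hom C S (src C f)" "\<psi> \<in> hom C S (src C g)"
  shows "\<exists>!h. h \<in> hom C S P \<and> p \<cdot> h = \<phi> \<cdot> restr C \<psi> \<and> q \<cdot> h = \<psi> \<cdot> restr C \<phi>"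
  using assms src_trg_Ob(1)[of \<phi>] unfolding weak_comma_def by (simp add: hom_iff[of \<phi>])

text \<open>A point of \<open>P\<close> at which \<open>p\<close> and \<open>q\<close> agree is
  determined by their common value, because lifts into \<open>P\<close> are unique.\<close>

lemma monic_meet_weak_comma:
  assumes comma: "weak_comma C a b P p q"
    and [simp]: "a \<in> Ar C" "src C a = A" "b \<in> Ar C" "src C b = A" "trg C a = trg C b"
  shows "monic C (p \<sqinter> q)"
proof -
  have [simp]: "P \<in> Ob C" "p \<in> Ar C" "src C p = P" "trg C p = A" "q \<in> Ar C" "src C q = P" "trg C q = A"
    and ab: "a \<cdot> p \<sqsubseteq> b \<cdot> q"
    using comma by (auto simp: weak_comma_def hom_iff)
  have [simp]: "A \<in> Ob C" using src_trg_Ob(1)[of a] by simp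
  let ?m = "p \<sqinter> q"
  let ?u = "\<pi>\<^sub>1 P P" and ?v = "\<pi>\<^sub>2 P P"
  \<comment> \<open>\<open>n\<close> is defined at the pairs of points of \<open>P\<close> that the
    meet sends to the same point, and its value is that common image.\<close>
  define n where "n = \<nabla> A \<cdot> (?m \<otimes> ?m)"
  have [simp]: "n \<in> Ar C" "src C n = P \<odot> P" "trg C n = A" by (simp_all add: n_def)
  let ?e = "restr C n"
  have "?m \<otimes> ?m = (?m \<otimes> ?m) \<cdot> \<langle>?u, ?v\<rangle>"
    by (simp add: pairing_proj_ident)
  then have n: "n = (?m \<cdot> ?u) \<sqinter> (?m \<cdot> ?v)"
    by (simp add: n_def meet_def tensor_pairing)
  have n_restr: "n = k \<cdot> w \<cdot> ?e" if "?m \<sqsubseteq> k" "n \<sqsubseteq> ?m \<cdot> w" "k \<in> Ar C" "src C k = P" "trg C k = A"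
    "w \<in> Ar C" "src C w = P \<odot> P" "trg C w = P" for k w
  proof -
    have "?m \<cdot> w \<sqsubseteq> k \<cdot> w" using that by (intro below_cmp_right) simp_all
    then have "n \<sqsubseteq> k \<cdot> w" using that by (intro below_trans'[OF that(2)]) simp_all
    then show ?thesis using that by (intro iffD1[OF below_iff_restr]) simp_all
  qed
  have mu: "n \<sqsubseteq> ?m \<cdot> ?u" and mv: "n \<sqsubseteq> ?m \<cdot> ?v"
    unfolding n by (rule meet_below_left meet_below_right; simp)+
  have mp: "?m \<sqsubseteq> p" and mq: "?m \<sqsubseteq> q" by (simp_all add: meet_below_left meet_below_right)
  have pu: "p \<cdot> (?u \<cdot> ?e) = n" and qu: "q \<cdot> (?u \<cdot> ?e) = n" and pv: "p \<cdot> (?v \<cdot> ?e) = n" and qv: "q \<cdot> (?v \<cdot> ?e) = n"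
    using n_restr[OF mp mu] n_restr[OF mq mu] n_restr[OF mp mv] n_restr[OF mq mv] by (simp_all add: cmp_reassoc)
  \<comment> \<open>On the domain of \<open>n\<close>, following either projection by
    \<open>p\<close> or by \<open>q\<close> gives \<open>n\<close>. Hence both restricted
    projections lift the pair of \<open>n\<close> with itself, and they coincide.\<close>
  have "a \<cdot> n \<sqsubseteq> b \<cdot> n"
    using below_cmp_right[OF ab, of "?u \<cdot> ?e"] by (simp add: cmp_reassoc pu qu)
  then have "\<exists>!h. h \<in> hom C (P \<odot> P) P \<and> p \<cdot> h = n \<cdot> ?e \<and> q \<cdot> h = n \<cdot> ?e"
    by (rule weak_comma_unique_lift[OF comma]) (simp_all add: hom_iff)
  moreover have "?u \<cdot> ?e \<in> hom C (P \<odot> P) P \<and> p \<cdot> (?u \<cdot> ?e) = n \<cdot> ?e \<and> q \<cdot> (?u \<cdot> ?e) = n \<cdot> ?e"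
    "?v \<cdot> ?e \<in> hom C (P \<odot> P) P \<and> p \<cdot> (?v \<cdot> ?e) = n \<cdot> ?e \<and> q \<cdot> (?v \<cdot> ?e) = n \<cdot> ?e"
    by (simp_all add: hom_iff pu qu pv qv)
  ultimately have uv: "?u \<cdot> ?e = ?v \<cdot> ?e"
    by blast
  have "n = ?m \<cdot> (?u \<cdot> ?e)"
    using mu by (subst (asm) below_iff_restr) (simp_all add: cmp_reassoc)
  also have "\<dots> = ?m \<cdot> (\<nabla> P \<cdot> \<langle>?u \<cdot> ?e, ?v \<cdot> ?e\<rangle>)"
    by (simp add: uv[symmetric] pairing_same cmp_subst_left[OF codiag_diag])
  also have "\<dots> = (?m \<cdot> \<nabla> P) \<cdot> ?e"
    by (simp add: pairing_proj cmp_reassoc)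
  finally have "n \<sqsubseteq> ?m \<cdot> \<nabla> P"
    by (subst below_iff_restr) simp_all
  \<comment> \<open>This inequality holds for any map in place of the meet, by naturality of
    \<Delta> and the counit of the adjunction.\<close>
  moreover have "?m \<cdot> \<nabla> P \<sqsubseteq> n"
  proof -
    have "?m \<cdot> \<nabla> P = (\<nabla> A \<cdot> (\<Delta> A \<cdot> ?m)) \<cdot> \<nabla> P"
      by (simp add: cmp_subst_left[OF codiag_diag])
    also have "\<dots> = n \<cdot> (\<Delta> P \<cdot> \<nabla> P)"
      by (simp add: diag_nat n_def cmp_reassoc)
    finally show ?thesis
      using below_cmp_left[OF adjunction_counit[of P], of n] by simp
  qed
  ultimately have "n = ?m \<cdot> \<nabla> P"
    by (rule below_antisym') simp_all
  then show ?thesis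
    by (simp add: monic_def n_def)
qed

lemma weak_comma_imp_Heyting:
  assumes comma: "weak_comma C a b P p q"
    and a: "restriction_idempotent C A a" and b: "restriction_idempotent C A b"
    and inv: "monics_have_quasi_inverses C"
  shows "\<exists>c. restriction_idempotent C A c \<and>
    (\<forall>S \<in> Ob C. \<forall>f \<in> hom C S A. a \<cdot> f \<sqsubseteq> b \<cdot> f \<longleftrightarrow> f \<sqsubseteq> c \<cdot> f)"
proof -
  have [simp]: "a \<in> Ar C" "src C a = A" "trg C a = A" "b \<in> Ar C" "src C b = A" "trg C b = A"
    using a b by (auto simp: restriction_idempotent_def hom_iff)
  have [simp]: "P \<in> Ob C" "p \<in> Ar C" "src C p = P" "trg C p = A" "q \<in> Ar C" "src C q = P" "trg C q = A"
    and ab: "a \<cdot> p \<sqsubseteq> b \<cdot> q"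
    using comma by (auto simp: weak_comma_def hom_iff)
  let ?m = "p \<sqinter> q"
  have "monic C ?m" by (rule monic_meet_weak_comma[OF comma]) simp_all
  then obtain m' where "quasi_inverse C ?m m'"
    using inv by (auto simp: monics_have_quasi_inverses_def)
  then have [simp]: "m' \<in> Ar C" "src C m' = A" "trg C m' = P"
    and m1: "m' \<cdot> ?m = restr C ?m" and m2: "?m \<cdot> m' = restr C m'"
    by (auto simp: quasi_inverse_def hom_iff)
  \<comment> \<open>On its domain the meet equals both \<open>p\<close> and \<open>q\<close>, so the
    comma inequality becomes one about a single map.\<close>
  have abm: "a \<cdot> ?m \<sqsubseteq> b \<cdot> ?m"
  proof -
    have "?m = p \<cdot> restr C ?m" "?m = q \<cdot> restr C ?m"
      by (rule iffD1[OF below_iff_restr]; simp add: meet_below_left meet_below_right)+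
    moreover have "a \<cdot> (p \<cdot> restr C ?m) \<sqsubseteq> b \<cdot> (q \<cdot> restr C ?m)"
      using below_cmp_right[OF ab, of "restr C ?m"] by (simp add: cmp_reassoc)
    ultimately show ?thesis by simp
  qed
  have "a \<cdot> f \<sqsubseteq> b \<cdot> f \<longleftrightarrow> f \<sqsubseteq> restr C m' \<cdot> f" if "S \<in> Ob C" "f \<in> hom C S A" for S f
  proof
    have [simp]: "f \<in> Ar C" "src C f = S" "trg C f = A" using that by (auto simp: hom_iff)
    show "f \<sqsubseteq> restr C m' \<cdot> f" if "a \<cdot> f \<sqsubseteq> b \<cdot> f"
    proof -
      \<comment> \<open>Lifting the pair of \<open>f\<close> with itself factors \<open>f\<close>
        through the meet, hence through its image, which is the domain of \<open>m'\<close>.\<close>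
      have "\<exists>!h. h \<in> hom C S P \<and> p \<cdot> h = f \<cdot> restr C f \<and> q \<cdot> h = f \<cdot> restr C f"
        by (rule weak_comma_unique_lift[OF comma that]) (simp_all add: hom_iff)
      then obtain h where [simp]: "h \<in> Ar C" "src C h = S" "trg C h = P" and h: "p \<cdot> h = f" "q \<cdot> h = f"
        by (auto simp: hom_iff)
      have mh: "?m \<cdot> h = f" by (simp add: meet_cmp h meet_same)
      have "restr C m' \<cdot> f = ?m \<cdot> ((m' \<cdot> ?m) \<cdot> h)"
        by (simp add: m2[symmetric] mh[symmetric] cmp_reassoc)
      also have "\<dots> = (?m \<cdot> restr C ?m) \<cdot> h"
        unfolding m1 by (rule cmp_reassoc[symmetric]) simp_all
      also have "\<dots> = f" by (simp add: mh)
      finally show ?thesis by (simp add: below_refl')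
    qed
    show "a \<cdot> f \<sqsubseteq> b \<cdot> f" if "f \<sqsubseteq> restr C m' \<cdot> f"
    proof -
      \<comment> \<open>A restriction of \<open>f\<close> always lies below \<open>f\<close>, so the
        hypothesis is an equality. It factors \<open>f\<close> through the meet, where
        \<open>abm\<close> applies.\<close>
      have "f = restr C m' \<cdot> f"
        by (rule below_antisym'[OF that]) (simp_all add: restr_cmp_below)
      then have f: "f = ?m \<cdot> (m' \<cdot> f)" by (simp add: m2[symmetric] cmp_reassoc)
      have "a \<cdot> (?m \<cdot> (m' \<cdot> f)) \<sqsubseteq> b \<cdot> (?m \<cdot> (m' \<cdot> f))"
        using below_cmp_right[OF abm, of "m' \<cdot> f"] by (simp add: cmp_reassoc)
      then show ?thesis by (simp only: f[symmetric])
    qed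
  qed
  then show ?thesis
    by (intro exI[of _ "restr C m'"]) (simp add: restriction_idempotent_def hom_iff)
qed

section \<open>From Heyting operations to weak comma objects\<close>

lemma split_mono_total:
  assumes [simp]: "i \<in> Ar C" "r \<in> Ar C" "trg C i = src C r" and ri: "r \<cdot> i = \<iota> (src C i)"
  shows "restr C i = \<iota> (src C i)"
proof -
  \<comment> \<open>The inserted factor is an identity; \<open>restr_cmp_restr\<close> then lets
    \<open>i\<close> absorb its own restriction.\<close>
  have "restr C i = restr C (r \<cdot> i) \<cdot> restr C i" by (simp add: ri)
  also have "\<dots> = restr C (r \<cdot> i \<cdot> restr C i)" by (simp add: restr_cmp_restr)
  also have "\<dots> = restr C (r \<cdot> i)" by (simp add: cmp_reassoc)
  finally show ?thesis by (simp add: ri)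
qed

lemma Heyting_imp_weak_comma:
  assumes [simp]: "f \<in> Ar C" "src C f = A" "trg C f = B" "g \<in> Ar C" "src C g = D" "trg C g = B"
    and split: "restriction_idempotents_split C"
    and Heyting: "has_stable_Heyting_operation C (A \<odot> D)"
  shows "\<exists>P p q. weak_comma C f g P p q"
proof -
  have [simp]: "A \<in> Ob C" "B \<in> Ob C" "D \<in> Ob C"
    using src_trg_Ob[of f] src_trg_Ob[of g] by simp_all
  let ?M = "A \<odot> D"
  let ?u = "\<pi>\<^sub>1 A D" and ?v = "\<pi>\<^sub>2 A D"
  let ?n = "(f \<cdot> ?u) \<sqinter> (g \<cdot> ?v)"
  \<comment> \<open>The premise of the implication is the set of pairs (x, y) with f x defined; the
    conclusion is the set of pairs with f x and g y defined and equal.\<close>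
  have "restriction_idempotent C ?M (restr C (f \<cdot> ?u))" "restriction_idempotent C ?M (restr C ?n)"
    by (simp_all add: restriction_idempotent_def hom_iff)
  then obtain c where c: "restriction_idempotent C ?M c"
    and c_iff: "\<And>S k. \<lbrakk>S \<in> Ob C; k \<in> hom C S ?M\<rbrakk>
      \<Longrightarrow> restr C (f \<cdot> ?u) \<cdot> k \<sqsubseteq> restr C ?n \<cdot> k \<longleftrightarrow> k \<sqsubseteq> c \<cdot> k"
    using Heyting unfolding has_stable_Heyting_operation_def by blast
  have "splits C ?M c"
    using split c unfolding restriction_idempotents_split_def by simp
  then obtain P r i where [simp]: "P \<in> Ob C" "r \<in> Ar C" "src C r = ?M" "trg C r = P"
    "i \<in> Ar C" "src C i = P" "trg C i = ?M" and c_eq: "c = i \<cdot> r" and ri: "r \<cdot> i = \<iota> P"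
    unfolding splits_def Bex_def hom_iff by blast
  have c_restr: "c = restr C c" using c by (simp add: restriction_idempotent_def)
  have [simp]: "c \<in> Ar C" "src C c = ?M" "trg C c = ?M" by (simp_all add: c_eq)
  let ?p = "?u \<cdot> i" and ?q = "?v \<cdot> i"
  have i_total: "restr C i = \<iota> P" using split_mono_total[of i r] by (simp add: ri)
  \<comment> \<open>The counit of A \<odot> D factors through each projection, so composing
    \<open>i\<close> with a projection keeps it total.\<close>
  have "restr C ?p = restr C i" "restr C ?q = restr C i"
    by (rule restr_cong; simp add: bang_tensor_proj1 cmp_reassoc)
      (rule restr_cong; simp add: bang_tensor_proj2 cmp_reassoc)
  then have total: "total C ?p" "total C ?q" by (simp_all add: total_def i_total)
  have n_below: "?n \<sqsubseteq> f \<cdot> ?u" "?n \<sqsubseteq> g \<cdot> ?v"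
    by (simp_all add: meet_below_left meet_below_right)
  have n_eq: "?n = f \<cdot> ?u \<cdot> restr C ?n"
    by (rule iffD1[OF below_iff_restr]) (simp_all add: meet_below_left)
  have below: "f \<cdot> ?p \<sqsubseteq> g \<cdot> ?q"
  proof -
    \<comment> \<open>The section \<open>i\<close> is fixed by \<open>c\<close>, so stability of the
      implication, tested on \<open>i\<close>, yields the comma inequality.\<close>
    have "i \<sqsubseteq> c \<cdot> i" by (simp add: c_eq cmp_reassoc ri below_refl')
    then have "restr C (f \<cdot> ?u) \<cdot> i \<sqsubseteq> restr C ?n \<cdot> i"
      using c_iff[of P i] by (simp add: hom_iff)
    then have "(f \<cdot> ?u) \<cdot> (restr C (f \<cdot> ?u) \<cdot> i) \<sqsubseteq> (f \<cdot> ?u) \<cdot> (restr C ?n \<cdot> i)"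
      by (rule below_cmp_left) simp_all
    moreover have "(f \<cdot> ?u) \<cdot> (restr C (f \<cdot> ?u) \<cdot> i) = f \<cdot> ?p"
      using cmp_subst_left[OF cmp_restr_self[of "f \<cdot> ?u"], of i] by (simp add: cmp_reassoc)
    moreover have "(f \<cdot> ?u) \<cdot> (restr C ?n \<cdot> i) = ?n \<cdot> i"
      by (subst (2) n_eq) (simp add: cmp_reassoc)
    ultimately have 1: "f \<cdot> ?p \<sqsubseteq> ?n \<cdot> i" by simp
    have "?n \<cdot> i \<sqsubseteq> g \<cdot> ?q"
      using below_cmp_right[OF n_below(2), of i] by (simp add: cmp_reassoc)
    then show ?thesis
      by (rule below_trans'[OF 1]) simp_all
  qed
  have "\<exists>!h. h \<in> hom C S P \<and> ?p \<cdot> h = \<phi> \<cdot> restr C \<psi> \<and> ?q \<cdot> h = \<psi> \<cdot> restr C \<phi>"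
    if "S \<in> Ob C" "\<phi> \<in> hom C S A" "\<psi> \<in> hom C S D" and le: "f \<cdot> \<phi> \<sqsubseteq> g \<cdot> \<psi>" for S \<phi> \<psi>
  proof -
    have [simp]: "S \<in> Ob C" "\<phi> \<in> Ar C" "src C \<phi> = S" "trg C \<phi> = A" "\<psi> \<in> Ar C" "src C \<psi> = S" "trg C \<psi> = D"
      using that by (auto simp: hom_iff)
    let ?k = "\<langle>\<phi>, \<psi>\<rangle>"
    let ?e = "restr C \<phi> \<cdot> restr C \<psi>"
    have uk: "?u \<cdot> ?k = \<phi> \<cdot> restr C \<psi>" and vk: "?v \<cdot> ?k = \<psi> \<cdot> restr C \<phi>"
      by (simp_all add: proj1_pairing proj2_pairing)
    \<comment> \<open>\<open>?e\<close> is the domain of the pairing; cutting both sides down to it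
      expresses the hypothesis through the projections of \<open>?k\<close>.\<close>
    have "(f \<cdot> \<phi>) \<cdot> ?e \<sqsubseteq> (g \<cdot> \<psi>) \<cdot> ?e"
      using le by (rule below_cmp_right) simp_all
    moreover have "(f \<cdot> \<phi>) \<cdot> ?e = f \<cdot> (?u \<cdot> ?k)"
      by (simp add: uk cmp_reassoc cmp_subst_left[OF cmp_restr_self])
    moreover have "(g \<cdot> \<psi>) \<cdot> ?e = g \<cdot> (?v \<cdot> ?k)"
      by (simp add: vk cmp_reassoc restr_commute[of \<phi> \<psi>] cmp_subst_left[OF cmp_restr_self])
    ultimately have "(f \<cdot> ?u) \<cdot> ?k \<sqsubseteq> (g \<cdot> ?v) \<cdot> ?k"
      by (simp add: cmp_reassoc)
    \<comment> \<open>The inequality says that the meet loses nothing of the left side along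
      \<open>?k\<close>. The two restrictions therefore agree there, which is what the Heyting
      operation tests.\<close>
    then have "((f \<cdot> ?u) \<cdot> ?k) \<sqinter> ((g \<cdot> ?v) \<cdot> ?k) = (f \<cdot> ?u) \<cdot> ?k"
      by (rule below_imp_meet) simp_all
    then have "?n \<cdot> ?k = (f \<cdot> ?u) \<cdot> ?k"
      by (simp add: meet_cmp)
    then have "restr C (f \<cdot> ?u) \<cdot> ?k = restr C ?n \<cdot> ?k"
      by (simp add: restr_cmp)
    then have "restr C (f \<cdot> ?u) \<cdot> ?k \<sqsubseteq> restr C ?n \<cdot> ?k"
      by (simp add: below_refl')
    then have "?k \<sqsubseteq> c \<cdot> ?k"
      using c_iff[of S ?k] by (simp add: hom_iff)
    moreover have "c \<cdot> ?k \<sqsubseteq> ?k"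
      using restr_cmp_below[of ?k c] by (simp add: c_restr[symmetric])
    ultimately have "c \<cdot> ?k = ?k"
      by (intro below_antisym') simp_all
    then have irk: "i \<cdot> (r \<cdot> ?k) = ?k" by (simp add: c_eq cmp_reassoc)
    show ?thesis
    proof (rule ex1I[of _ "r \<cdot> ?k"])
      show "r \<cdot> ?k \<in> hom C S P \<and> ?p \<cdot> (r \<cdot> ?k) = \<phi> \<cdot> restr C \<psi> \<and> ?q \<cdot> (r \<cdot> ?k) = \<psi> \<cdot> restr C \<phi>"
        by (simp add: hom_iff cmp_reassoc irk uk vk)
    next
      \<comment> \<open>The projections determine a map into A \<odot> D by
        \<open>pairing_proj\<close>, and \<open>i\<close> has the left inverse
        \<open>r\<close>.\<close>
      fix h assume "h \<in> hom C S P \<and> ?p \<cdot> h = \<phi> \<cdot> restr C \<psi> \<and> ?q \<cdot> h = \<psi> \<cdot> restr C \<phi>"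
      then have [simp]: "h \<in> Ar C" "src C h = S" "trg C h = P"
        and h: "?u \<cdot> (i \<cdot> h) = ?u \<cdot> ?k" "?v \<cdot> (i \<cdot> h) = ?v \<cdot> ?k"
        by (auto simp: hom_iff cmp_reassoc uk vk)
      have "i \<cdot> h = \<langle>?u \<cdot> (i \<cdot> h), ?v \<cdot> (i \<cdot> h)\<rangle>" by (simp add: pairing_proj)
      also have "\<dots> = ?k" unfolding h by (rule pairing_proj) simp_all
      finally have "r \<cdot> (i \<cdot> h) = r \<cdot> ?k" by simp
      then show "h = r \<cdot> ?k" by (simp add: cmp_subst_left[OF ri])
    qed
  qed
  then have "weak_comma C f g P ?p ?q"
    using total below by (simp add: weak_comma_def hom_iff[of ?p] hom_iff[of ?q])
  then show ?thesis by blast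
qed

end

theorem theorem3:
  fixes C :: "('o, 'm, 'x) partial_cartesian_cat_scheme"
  assumes "partial_cartesian_category C"
    and "restriction_idempotents_split C"
    and "monics_have_quasi_inverses C"
  shows "has_weak_comma_objects C \<longleftrightarrow> (\<forall>A \<in> Ob C. has_stable_Heyting_operation C A)"
proof -
  interpret partial_cartesian_category C by fact
  show ?thesis
  proof
    assume comma: "has_weak_comma_objects C"
    show "\<forall>A \<in> Ob C. has_stable_Heyting_operation C A"
      unfolding has_stable_Heyting_operation_def
    proof (intro ballI allI impI)
      fix A a b
      assume "A \<in> Ob C" and a: "restriction_idempotent C A a" and b: "restriction_idempotent C A b"
      then obtain P p q where "weak_comma C a b P p q"
        using comma unfolding has_weak_comma_objects_def restriction_idempotent_def by blast
      from weak_comma_imp_Heyting[OF this a b assms(3)]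
      show "\<exists>c. restriction_idempotent C A c \<and>
        (\<forall>S \<in> Ob C. \<forall>f \<in> hom C S A.
          below C (cmp C a f) (cmp C b f) \<longleftrightarrow> below C f (cmp C c f))" .
    qed
  next
    assume "\<forall>A \<in> Ob C. has_stable_Heyting_operation C A"
    then show "has_weak_comma_objects C"
      unfolding has_weak_comma_objects_def
      by (auto simp: hom_iff intro!: Heyting_imp_weak_comma[OF _ refl _ _ refl _ assms(2)])
  qed
qed

end
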